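(* Let $u:\mathbb{R}^2\to\mathbb{R}$ be a solution of the Liouville equation $-\Delta u=e^{2u}$ in $\mathbb{R}^2$. Then $u$ is bounded from above if and only if there exist $\lambda\in\mathbb{C}\setminus\{0\}$, $z_0\in\mathbb{C}$ and a function $U:\mathbb{R}^2\to\mathbb{R}$ such that $u(z)=\ln|\lambda|+U(\lambda z+z_0)$ for all $z\in\mathbb{C}$, where either $$U(x,y)=\ln\left(\frac{2}{1+x^2+y^2}\right),$$ or $$U(x,y)=\ln\left(\frac{2e^x}{1+t^2+2te^x\cos y+e^{2x}}\right)\quad\text{for some } t\ge 0.$$
   Context: $\mathbb{R}^2$ is identified with $\mathbb{C}$ via $z=x+iy$. A solution means a classical ($C^2$) real-valued solution on all of $\mathbb{R}^2$. *)

theory Defs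
  imports "HOL-Analysis.Analysis"
begin

(* For 'a = complex the basis vectors are 1 and \<i>, so these are the operators
   d/dx and d/dy under z = x + iy (see laplacian_complex below). *)
definition partial_deriv :: "'a::euclidean_space \<Rightarrow> ('a \<Rightarrow> real) \<Rightarrow> 'a \<Rightarrow> real" where
  "partial_deriv b f x = deriv (\<lambda>t::real. f (x + t *\<^sub>R b)) 0"

(* Existence is required separately because deriv is total: it returns an
   unspecified value where the derivative does not exist. *)
definition C1 :: "('a::euclidean_space \<Rightarrow> real) \<Rightarrow> bool" where
  "C1 f \<longleftrightarrow> continuous_on UNIV f \<and>
     (\<forall>b\<in>Basis. (\<forall>x. (\<lambda>t::real. f (x + t *\<^sub>R b)) differentiable (at 0)) \<and>
                 continuous_on UNIV (partial_deriv b f))"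

definition C2 :: "('a::euclidean_space \<Rightarrow> real) \<Rightarrow> bool" where
  "C2 f \<longleftrightarrow> C1 f \<and> (\<forall>b\<in>Basis. C1 (partial_deriv b f))"

definition laplacian :: "('a::euclidean_space \<Rightarrow> real) \<Rightarrow> 'a \<Rightarrow> real" where
  "laplacian f x = (\<Sum>b\<in>Basis. partial_deriv b (partial_deriv b f) x)"

lemma laplacian_complex:
  fixes f :: "complex \<Rightarrow> real"
  shows "laplacian f z =
    partial_deriv 1 (partial_deriv 1 f) z + partial_deriv \<i> (partial_deriv \<i> f) z"
  by (simp add: laplacian_def Basis_complex_def)

definition liouville_solution :: "(complex \<Rightarrow> real) \<Rightarrow> bool" where
  "liouville_solution u \<longleftrightarrow> C2 u \<and> (\<forall>z. - laplacian u z = exp (2 * u z))"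

end

theory Submission
  imports Defs "HOL-Complex_Analysis.Complex_Analysis"
begin

text \<open>
  Write p = u_z for the complex derivative of the solution u. The Liouville equation says that the
  derivative of p with respect to the conjugate variable is -exp(2u)/4, and it forces
  q = u_zz - (u_z)^2, half the Schwarzian derivative of a developing map of u, to be entire
  (lemma \<open>holomorphic_q\<close>). The whole proof for solutions with u \<le> M consists in showing that
  q is constant (lemma \<open>q_constant\<close>) and then integrating a linear system with constant
  coefficients.

  Growth. The Fourier modes of u and p on circles satisfy first order equations in the radius whose
  inhomogeneity is a mode of exp(2u), a bounded function. Since M - u is nonnegative, its first mode
  is dominated by its mean, and the mean is controlled by the value at the centre. On a circle of
  radius r this gives |p| \<le> (M - u)/r + O(r) at the centre; the best r yields
  |p| = O(sqrt (M + 1 - u)). Hence sqrt (M + 1 - u) is Lipschitz and p grows at most linearly. The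
  same mode equation applied to p bounds the derivative p_z = q + p^2 at a point by the supremum of
  |p| over a unit disc (lemma \<open>p_z_bound\<close>). So q grows at most quadratically and is a polynomial
  of degree at most 2.

  Rigidity. Suppose that q has degree d \<ge> 1 and leading coefficient a. Then p^2 = p_z - q is of
  order |z|^d at most, so that p_z, controlled by p, is of order |z|^(d/2), which is negligible
  against q. Therefore p^2 is asymptotic to -a z^d in all directions. In a logarithmic coordinate p
  is a fixed branch of the square root of -a z^d up to a factor near 1, and the exponential
  exp((d/2 + 1) w) takes every argument, so along a suitable ray the derivative of u with respect to
  log |z|, which is twice the real part of z p, stays above a positive constant. Then u is unbounded,
  a contradiction (lemma \<open>no_p_squared_asymptotics\<close>).

  Integration. For constant q = k the function g = exp(-u) satisfies g_zz = -k g and the conjugate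
  equation, and g times its mixed second derivative minus |g_z|^2 is constantly 1/4. If k = 0, g is a
  quadratic polynomial in z and its conjugate; if k = -b^2 is nonzero, g is a combination of the four
  exponentials exp(\<plusminus> b z \<plusminus> cnj (b z)). The identity with 1/4 is exactly what normalises the
  coefficients to the two families (lemmas \<open>zero_case\<close> and \<open>nonzero_case\<close>). Conversely, both profiles
  are bounded above by elementary estimates.
\<close>

section \<open>Wirtinger derivatives\<close>

text \<open>Real differentiability of a complex function, with the real-linear derivative written in the basis
  \<open>h\<close>, \<open>cnj h\<close>. The coefficients are the usual derivatives with respect to z and its
  conjugate; carrying both makes sums, products and compositions computable without coordinates.\<close>

definition wirtinger :: "(complex \<Rightarrow> complex) \<Rightarrow> complex \<Rightarrow> complex \<Rightarrow> complex \<Rightarrow> bool" where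
  "wirtinger f a b z \<longleftrightarrow> (f has_derivative (\<lambda>h. a * h + b * cnj h)) (at z)"

lemma wirtinger_const: "wirtinger (\<lambda>z. c) 0 0 z"
  by (simp add: wirtinger_def)

lemma wirtinger_add:
  "wirtinger f a b z \<Longrightarrow> wirtinger g a' b' z \<Longrightarrow> wirtinger (\<lambda>z. f z + g z) (a + a') (b + b') z"
  unfolding wirtinger_def
  by (rule has_derivative_eq_rhs, rule has_derivative_add, assumption, assumption)
     (simp add: fun_eq_iff algebra_simps)

lemma wirtinger_minus:
  "wirtinger f a b z \<Longrightarrow> wirtinger (\<lambda>z. - f z) (- a) (- b) z"
  unfolding wirtinger_def
  by (rule has_derivative_eq_rhs, rule has_derivative_minus, assumption)
     (simp add: fun_eq_iff algebra_simps)

lemma wirtinger_mult: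
  "wirtinger f a b z \<Longrightarrow> wirtinger g a' b' z \<Longrightarrow>
   wirtinger (\<lambda>z. f z * g z) (a * g z + f z * a') (b * g z + f z * b') z"
  unfolding wirtinger_def
  by (rule has_derivative_eq_rhs, rule has_derivative_mult, assumption, assumption)
     (simp add: fun_eq_iff algebra_simps)

lemma wirtinger_cmult:
  "wirtinger f a b z \<Longrightarrow> wirtinger (\<lambda>z. c * f z) (c * a) (c * b) z"
  using wirtinger_mult[OF wirtinger_const[of c z]] by fastforce

lemma wirtinger_cnj:
  assumes "wirtinger f a b z" shows "wirtinger (\<lambda>z. cnj (f z)) (cnj b) (cnj a) z"
proof -
  have "((\<lambda>z. cnj (f z)) has_derivative (\<lambda>h. cnj (a * h + b * cnj h))) (at z)"
    using assms unfolding wirtinger_def by (rule has_derivative_cnj)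
  then show ?thesis unfolding wirtinger_def
    by (rule has_derivative_eq_rhs) (simp add: fun_eq_iff algebra_simps)
qed

lemma wirtinger_chain:
  assumes "wirtinger f a b z" "(F has_field_derivative d) (at (f z))"
  shows "wirtinger (\<lambda>z. F (f z)) (d * a) (d * b) z"
proof -
  have "(f has_derivative (\<lambda>h. a * h + b * cnj h)) (at z)"
    using assms unfolding wirtinger_def by blast
  from diff_chain_at[OF this, of F "\<lambda>h. d * h"] assms(2)
  have "((F \<circ> f) has_derivative (\<lambda>h. d * h) \<circ> (\<lambda>h. a * h + b * cnj h)) (at z)"
    by (simp add: has_field_derivative_def)
  then show ?thesis unfolding wirtinger_def o_def
    by (rule has_derivative_eq_rhs) (simp add: fun_eq_iff algebra_simps)
qed

lemma wirtinger_exp: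
  "wirtinger f a b z \<Longrightarrow> wirtinger (\<lambda>z. exp (f z)) (exp (f z) * a) (exp (f z) * b) z"
  by (erule wirtinger_chain) (rule DERIV_exp)

lemma wirtinger_holo:
  "(f has_field_derivative d) (at z) \<longleftrightarrow> wirtinger f d 0 z"
  by (simp add: wirtinger_def has_field_derivative_def)

lemma wirtinger_continuous:
  assumes "\<And>z. wirtinger f (a z) (b z) z" shows "continuous_on S f"
  using assms unfolding wirtinger_def
  by (meson continuous_at_imp_continuous_on has_derivative_continuous)

lemma wirtinger_path:
  assumes "wirtinger f a b (g t)" "(g has_vector_derivative d) (at t)"
  shows "((\<lambda>t. f (g t)) has_vector_derivative (a * d + b * cnj d)) (at t)"
proof -
  from assms have "((f \<circ> g) has_derivative (\<lambda>h. a * h + b * cnj h) \<circ> (\<lambda>h. h *\<^sub>R d)) (at t)"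
    unfolding wirtinger_def has_vector_derivative_def
    by (intro diff_chain_at) auto
  then show ?thesis unfolding has_vector_derivative_def o_def
    by (rule has_derivative_eq_rhs) (simp add: fun_eq_iff algebra_simps scaleR_conv_of_real)
qed

lemma wirtinger_zero_const:
  assumes "\<And>z. wirtinger f 0 0 z" shows "f z = f 0"
proof -
  have "(f has_field_derivative 0) (at z)" for z
    using assms by (simp add: wirtinger_holo)
  then show ?thesis
    using has_field_derivative_zero_constant[of UNIV f] by fastforce
qed

section \<open>Functions with continuous partial derivatives\<close>

lemma C1_line:
  fixes f :: "complex \<Rightarrow> real"
  assumes "C1 f" "e \<in> Basis"
  shows "((\<lambda>t. f (z + t *\<^sub>R e)) has_real_derivative partial_deriv e f (z + s *\<^sub>R e)) (at s)"
proof -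
  have "(\<lambda>t. f ((z + s *\<^sub>R e) + t *\<^sub>R e)) differentiable (at 0)"
    using assms unfolding C1_def by blast
  then have "((\<lambda>t. f ((z + s *\<^sub>R e) + t *\<^sub>R e)) has_real_derivative partial_deriv e f (z + s *\<^sub>R e)) (at 0)"
    unfolding partial_deriv_def
    by (metis DERIV_imp_deriv real_differentiable_def)
  then have "((\<lambda>t. f ((z + s *\<^sub>R e) + (t - s) *\<^sub>R e)) has_real_derivative partial_deriv e f (z + s *\<^sub>R e)) (at s)"
    using DERIV_shift[of "\<lambda>t. f ((z + s *\<^sub>R e) + t *\<^sub>R e)" _ s "-s"] by simp
  then show ?thesis by (simp add: algebra_simps)
qed

lemma C1_x: "C1 f \<Longrightarrow> ((\<lambda>x. f (Complex x y)) has_real_derivative partial_deriv 1 f (Complex x y)) (at x)"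
  using C1_line[of f 1 "Complex 0 y" x] by (simp add: Basis_complex_def complex_eq_iff plus_complex.code)

lemma Complex_plus_i: "Complex x 0 + t *\<^sub>R \<i> = Complex x t" by (simp add: complex_eq_iff)
lemma C1_y: "C1 f \<Longrightarrow> ((\<lambda>y. f (Complex x y)) has_real_derivative partial_deriv \<i> f (Complex x y)) (at y)"
  using C1_line[of f \<i> "Complex x 0" y] by (simp add: Basis_complex_def Complex_plus_i)

lemma C1_continuous:
  fixes f :: "complex \<Rightarrow> real"
  shows "C1 f \<Longrightarrow> e \<in> Basis \<Longrightarrow> continuous_on UNIV (partial_deriv e f)"
  by (simp add: C1_def)

lemma continuous_on_Complex[continuous_intros]:
  assumes "continuous_on S f" "continuous_on S g"
  shows "continuous_on S (\<lambda>x. Complex (f x) (g x))"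
  using assms unfolding Complex_eq by (intro continuous_intros)

text \<open>Continuous partial derivatives combine to a Frechet derivative; this connects the coordinatewise definition of \<open>C1\<close> with the Wirtinger calculus.\<close>

lemma C1_has_derivative:
  fixes f :: "complex \<Rightarrow> real"
  assumes "C1 f"
  shows "(f has_derivative (\<lambda>h. Re h * partial_deriv 1 f z + Im h * partial_deriv \<i> f z)) (at z)"
proof -
  have c: "continuous_on UNIV (partial_deriv \<i> f)" 
    using assms by (simp add: C1_continuous Basis_complex_def)
  have "((\<lambda>(x, y). f (Complex x y)) has_derivative
     (\<lambda>(tx, ty). tx * partial_deriv 1 f z + blinfun_scaleR_left (partial_deriv \<i> f z) ty))
       (at (Re z, Im z) within UNIV \<times> UNIV)"
  proof -
    have "((\<lambda>(x, y). f (Complex x y)) has_derivative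
     (\<lambda>(tx, ty). tx * partial_deriv 1 f (Complex (Re z) (Im z)) + blinfun_scaleR_left (partial_deriv \<i> f (Complex (Re z) (Im z))) ty))
       (at (Re z, Im z) within UNIV \<times> UNIV)"
    proof (rule has_derivative_partialsI)
      show "((\<lambda>x. f (Complex x (Im z))) has_derivative (\<lambda>tx. tx * partial_deriv 1 f (Complex (Re z) (Im z)))) (at (Re z))"
        using C1_x[OF assms, of "Im z" "Re z"] by (simp add: has_field_derivative_def mult_commute_abs)
      show "((\<lambda>y. f (Complex x y)) has_derivative blinfun_apply (blinfun_scaleR_left (partial_deriv \<i> f (Complex x y)))) (at y)" for x y
        using C1_y[OF assms, of x y] by (simp add: has_field_derivative_def mult_commute_abs)
      have "continuous_on UNIV (\<lambda>(x, y). partial_deriv \<i> f (Complex x y))"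
        unfolding split_beta
        by (rule continuous_on_compose2[OF c]) (auto intro!: continuous_intros)
      then have "continuous_on UNIV (\<lambda>(x, y). blinfun_scaleR_left (partial_deriv \<i> f (Complex x y)))"
        unfolding split_beta
        by (rule bounded_linear.continuous_on[OF bounded_linear_blinfun_scaleR_left])
      then show "continuous (at (Re z, Im z) within UNIV \<times> UNIV) (\<lambda>(x, y). blinfun_scaleR_left (partial_deriv \<i> f (Complex x y)))"
        by (simp add: continuous_on_eq_continuous_within)
    qed auto
    then show ?thesis by simp
  qed
  then have *: "((\<lambda>(x, y). f (Complex x y)) has_derivative
     (\<lambda>(tx, ty). tx * partial_deriv 1 f z + ty * partial_deriv \<i> f z)) (at (Re z, Im z))" by simp
  have "((\<lambda>z. (Re z, Im z)) has_derivative (\<lambda>h. (Re h, Im h))) (at z)"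
    by (intro derivative_intros has_derivative_Re has_derivative_Im)
  from diff_chain_at[OF this, of "\<lambda>(x, y). f (Complex x y)", OF *]
  show ?thesis by (simp add: o_def)
qed

lemma C1_wirtinger:
  fixes f :: "complex \<Rightarrow> real"
  assumes "C1 f"
  shows "wirtinger (\<lambda>z. of_real (f z))
     (Complex (partial_deriv 1 f z) (- partial_deriv \<i> f z) / 2)
     (Complex (partial_deriv 1 f z) (partial_deriv \<i> f z) / 2) z"
  unfolding wirtinger_def
  by (rule has_derivative_eq_rhs, rule has_derivative_of_real, rule C1_has_derivative[OF assms])
     (simp add: fun_eq_iff complex_eq_iff field_simps)

text \<open>Schwarz's theorem. Integrate the x-derivative along horizontal segments, differentiate the result in y
  under the integral sign, and recover the mixed derivative by the fundamental theorem of calculus.\<close>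

lemma C2_mixed_partials:
  fixes f :: "complex \<Rightarrow> real"
  assumes "C2 f"
  shows "partial_deriv 1 (partial_deriv \<i> f) z = partial_deriv \<i> (partial_deriv 1 f) z"
proof -
  define fx fy where "fx = partial_deriv 1 f" and "fy = partial_deriv \<i> f"
  have C: "C1 f" "C1 fx" "C1 fy"
    using assms by (auto simp: C2_def fx_def fy_def Basis_complex_def)
  have cont: "continuous_on UNIV fx" "continuous_on UNIV (partial_deriv \<i> fx)"
     using C by (auto simp: C1_def Basis_complex_def)
  define x y where "x = Re z" and "y = Im z"
  have z: "z = Complex x y" by (simp add: x_def y_def)
  have main: "((\<lambda>s. fy (Complex s y)) has_real_derivative partial_deriv \<i> fx z) (at x within {x-1..x+1})"
  proof -
    \<comment> \<open>The base point \<open>x - 1\<close> lies to the left of x, so that all integrals run over nonempty intervals near x.\<close>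
    have FTC: "f (Complex s t) = f (Complex (x-1) t) + integral {x-1..s} (\<lambda>r. fx (Complex r t))"
      if "s \<ge> x-1" for s t
    proof -
      have "((\<lambda>r. fx (Complex r t)) has_integral f (Complex s t) - f (Complex (x-1) t)) {x-1..s}"
        using that by (intro fundamental_theorem_of_calculus)
          (auto simp: has_real_derivative_iff_has_vector_derivative[symmetric] fx_def
              intro: has_field_derivative_at_within C1_x[OF C(1)])
      then show ?thesis by (simp add: integral_unique)
    qed
    have fy: "fy (Complex s y) = fy (Complex (x-1) y) + integral {x-1..s} (\<lambda>r. partial_deriv \<i> fx (Complex r y))"
      if "s \<ge> x-1" for s
    proof -
      have "((\<lambda>t. integral (cbox (x-1) s) (\<lambda>r. fx (Complex r t))) has_real_derivative
          integral (cbox (x-1) s) (\<lambda>r. partial_deriv \<i> fx (Complex r y))) (at y within UNIV)"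
      proof (rule leibniz_rule_field_derivative)
        show "((\<lambda>t. fx (Complex r t)) has_real_derivative partial_deriv \<i> fx (Complex r t)) (at t within UNIV)" for r t
          using C1_y[OF C(2)] by simp
        show "(\<lambda>r. fx (Complex r t)) integrable_on cbox (x - 1) s" for t
          by (rule integrable_continuous, rule continuous_on_compose2[OF cont(1)])
             (intro continuous_intros, simp)
        show "continuous_on (UNIV \<times> cbox (x - 1) s) (\<lambda>(t, r). partial_deriv \<i> fx (Complex r t))"
          unfolding split_beta
          by (rule continuous_on_compose2[OF cont(2)]) (intro continuous_intros, simp)
      qed auto
      from DERIV_add[OF C1_y[OF C(1), of "x-1" y] this]
      have "((\<lambda>t. f (Complex s t)) has_real_derivative fy (Complex (x-1) y) + integral {x-1..s} (\<lambda>r. partial_deriv \<i> fx (Complex r y))) (at y)"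
        using FTC[OF that] by (simp add: fy_def)
      with C1_y[OF C(1), of s y] show ?thesis
        unfolding fy_def by (rule DERIV_unique)
    qed
    have "((\<lambda>s. integral {x-1..s} (\<lambda>r. partial_deriv \<i> fx (Complex r y))) has_vector_derivative
       partial_deriv \<i> fx (Complex x y)) (at x within {x-1..x+1})"
    proof (rule integral_has_vector_derivative)
      show "continuous_on {x-1..x+1} (\<lambda>r. partial_deriv \<i> fx (Complex r y))"
        by (rule continuous_on_compose2[OF cont(2)]) (intro continuous_intros, simp)
    qed simp
    from has_vector_derivative_add[OF has_vector_derivative_const this]
    have "((\<lambda>s. fy (Complex (x-1) y) + integral {x-1..s} (\<lambda>r. partial_deriv \<i> fx (Complex r y))) has_real_derivative
       partial_deriv \<i> fx (Complex x y)) (at x within {x-1..x+1})"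
      unfolding has_real_derivative_iff_has_vector_derivative by simp
    then have "((\<lambda>s. fy (Complex s y)) has_real_derivative
       partial_deriv \<i> fx (Complex x y)) (at x within {x-1..x+1})"
      by (rule has_field_derivative_transform_within[where d=1]) (simp, simp, rule fy[symmetric], simp)
    then show ?thesis using z by simp
  qed
  have "((\<lambda>s. fy (Complex s y)) has_real_derivative partial_deriv 1 fy z) (at x within {x-1..x+1})"
    using C1_x[OF C(3), of y x] z by (auto intro: has_field_derivative_at_within)
  then have "partial_deriv 1 fy z = partial_deriv \<i> fx z"
    using main unfolding has_real_derivative_iff_has_vector_derivative
    by (intro vector_derivative_unique_within[of x "{x-1..x+1}"])
       (auto simp: trivial_limit_within islimpt_Icc)
  then show ?thesis by (simp add: fx_def fy_def)
qed

section \<open>Closed one-forms on the plane\<close>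

definition wirtinger_blinfun :: "complex \<Rightarrow> complex \<Rightarrow> complex \<Rightarrow>\<^sub>L complex" where
  "wirtinger_blinfun a b = blinfun_mult_right a + (blinfun_mult_right b o\<^sub>L Blinfun cnj)"

lemma wirtinger_blinfun_apply: "blinfun_apply (wirtinger_blinfun a b) = (\<lambda>h. a * h + b * cnj h)"
  by (simp add: fun_eq_iff wirtinger_blinfun_def plus_blinfun.rep_eq bounded_linear_Blinfun_apply bounded_linear_cnj)

lemma continuous_on_wirtinger_blinfun:
  assumes "continuous_on S a" "continuous_on S b"
  shows "continuous_on S (\<lambda>x. wirtinger_blinfun (a x) (b x))"
  unfolding wirtinger_blinfun_def
  by (intro continuous_intros assms bounded_linear.continuous_on[OF bounded_linear_blinfun_mult_right])

text \<open>The Poincare lemma for the form \<open>G dz + F d(cnj z)\<close>, which is closed because the z-derivative of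
  F and the conjugate derivative of G agree (both are \<open>Fa\<close>). The primitive is the integral along the segment
  from 0; closedness turns the derivative of its integrand in direction h into the total t-derivative of
  \<open>t (F (t z) cnj h + G (t z) h)\<close>.\<close>

lemma closed_form_exact:
  fixes F G :: "complex \<Rightarrow> complex"
  assumes F: "\<And>z. wirtinger F (Fa z) (Fb z) z" and G: "\<And>z. wirtinger G (Ga z) (Fa z) z"
    and cont: "continuous_on UNIV Fa" "continuous_on UNIV Fb" "continuous_on UNIV Ga"
  obtains P where "\<And>z. wirtinger P (G z) (F z) z"
proof -
  define K where "K = (\<lambda>z (t::real). F (of_real t * z) * cnj z + G (of_real t * z) * z)"
  define a where "a = (\<lambda>z (t::real). of_real t * Fa (of_real t * z) * cnj z + of_real t * Ga (of_real t * z) * z + G (of_real t * z))"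
  define b where "b = (\<lambda>z (t::real). of_real t * Fb (of_real t * z) * cnj z + F (of_real t * z) + of_real t * Fa (of_real t * z) * z)"
  have contF: "continuous_on UNIV F" and contG: "continuous_on UNIV G"
    using wirtinger_continuous F G by blast+
  note c' = continuous_on_compose2[OF cont(1)] continuous_on_compose2[OF cont(2)]
     continuous_on_compose2[OF cont(3)] continuous_on_compose2[OF contF] continuous_on_compose2[OF contG]
  define P where "P = (\<lambda>z. integral (cbox 0 1) (K z))"
  have der: "(P has_derivative blinfun_apply (integral (cbox 0 1) (\<lambda>t. wirtinger_blinfun (a z t) (b z t)))) (at z within UNIV)" for z
    unfolding P_def
  proof (rule leibniz_rule)
    fix z :: complex and t :: real
    have sc: "((\<lambda>z. of_real t * z) has_derivative (\<lambda>h. of_real t * h)) (at z)"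
      by (rule bounded_linear.has_derivative[OF bounded_linear_mult_right has_derivative_ident])
    have comp: "wirtinger (\<lambda>z. f (of_real t * z)) (of_real t * fa) (of_real t * fb) z"
      if "wirtinger f fa fb (of_real t * z)" for f fa fb
      using diff_chain_at[OF sc that[unfolded wirtinger_def]] unfolding wirtinger_def o_def
      by (rule has_derivative_eq_rhs) (simp add: fun_eq_iff algebra_simps)
    have id: "wirtinger (\<lambda>z. z) 1 0 z" by (simp add: wirtinger_def)
    from wirtinger_add[OF wirtinger_mult[OF comp[OF F] wirtinger_cnj[OF id]] wirtinger_mult[OF comp[OF G] id]]
    have "wirtinger (\<lambda>z. K z t) (a z t) (b z t) z"
      unfolding K_def a_def b_def by (simp add: algebra_simps)
    then show "((\<lambda>z. K z t) has_derivative blinfun_apply (wirtinger_blinfun (a z t) (b z t))) (at z within UNIV)"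
      by (simp add: wirtinger_def wirtinger_blinfun_apply)
  next
    show "K z integrable_on cbox 0 1" for z
      unfolding K_def by (intro integrable_continuous continuous_intros c') auto
    show "continuous_on (UNIV \<times> cbox 0 1) (\<lambda>(z, t). wirtinger_blinfun (a z t) (b z t))"
      unfolding split_beta a_def b_def
      by (intro continuous_on_wirtinger_blinfun continuous_intros c') auto
  qed auto
  have "wirtinger P (G z) (F z) z" for z
    unfolding wirtinger_def
  proof (rule has_derivative_eq_rhs[OF der[of z, unfolded]], simp, rule ext)
    fix h
    have int: "(\<lambda>t. wirtinger_blinfun (a z t) (b z t)) integrable_on {0..1}"
      unfolding a_def b_def
      by (intro integrable_continuous_real continuous_on_wirtinger_blinfun continuous_intros c') auto
    have "blinfun_apply (integral {0..1} (\<lambda>t. wirtinger_blinfun (a z t) (b z t))) h =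
        integral {0..1} (\<lambda>t. a z t * h + b z t * cnj h)"
      using blinfun_apply_integral[OF int, of h] by (simp add: wirtinger_blinfun_apply)
    also have "((\<lambda>t. a z t * h + b z t * cnj h) has_integral
        (of_real 1 * (F (of_real 1 * z) * cnj h + G (of_real 1 * z) * h)
          - of_real 0 * (F (of_real 0 * z) * cnj h + G (of_real 0 * z) * h))) {0..1}"
    proof (rule fundamental_theorem_of_calculus)
      fix t :: real
      have l: "((\<lambda>t. of_real t * z) has_vector_derivative z) (at t)"
        by (auto intro!: derivative_eq_intros simp: has_vector_derivative_def scaleR_conv_of_real)
      have i: "((\<lambda>t. of_real t) has_vector_derivative (1::complex)) (at t)"
        by (auto intro!: derivative_eq_intros simp: has_vector_derivative_def scaleR_conv_of_real)
      have "((\<lambda>t. of_real t * (F (of_real t * z) * cnj h + G (of_real t * z) * h) :: complex) has_vector_derivative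
          a z t * h + b z t * cnj h) (at t)"
        by (rule has_vector_derivative_eq_rhs)
           (rule derivative_intros wirtinger_path[OF F l] wirtinger_path[OF G l] i |
            simp add: a_def b_def algebra_simps)+
      then show "((\<lambda>t. of_real t * (F (of_real t * z) * cnj h + G (of_real t * z) * h) :: complex) has_vector_derivative
          a z t * h + b z t * cnj h) (at t within {0..1})"
        by (rule has_vector_derivative_at_within)
    qed simp
    then have "integral {0..1} (\<lambda>t. a z t * h + b z t * cnj h) = F z * cnj h + G z * h"
      by (simp add: integral_unique)
    finally show "blinfun_apply (integral {0..1} (\<lambda>t. wirtinger_blinfun (a z t) (b z t))) h = G z * h + F z * cnj h"
      by simp
  qed
  then show ?thesis using that by blast
qed

section \<open>Fourier modes on circles\<close>

definition fmode :: "int \<Rightarrow> (complex \<Rightarrow> complex) \<Rightarrow> complex \<Rightarrow> real \<Rightarrow> complex" where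
  "fmode n f c r = integral {0..2*pi} (\<lambda>t. f (c + of_real r * cis t) * cis (- of_int n * t)) / of_real (2 * pi)"

lemma continuous_on_fmode_integrand:
  assumes "continuous_on UNIV f"
  shows "continuous_on S (\<lambda>t. f (c + of_real r * cis t) * cis (- of_int n * t))"
  by (intro continuous_intros continuous_on_compose2[OF assms] continuous_on_cis) auto

lemma fmode_integrable:
  assumes "continuous_on UNIV f"
  shows "(\<lambda>t. f (c + of_real r * cis t) * cis (- of_int n * t)) integrable_on {0..2*pi}"
  by (intro integrable_continuous_real continuous_on_fmode_integrand assms)

lemma fmode_bound:
  assumes "continuous_on UNIV f" "\<And>t. norm (f (c + of_real r * cis t)) \<le> K"
  shows "norm (fmode n f c r) \<le> K"
proof -
  have "norm (integral {0..2*pi} (\<lambda>t. f (c + of_real r * cis t) * cis (- of_int n * t))) \<le> K * (2 * pi - 0)"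
    using assms by (intro integral_bound continuous_on_fmode_integrand) (auto simp: norm_mult)
  then show ?thesis
    by (simp add: fmode_def norm_divide field_simps)
qed

lemma fmode_add:
  assumes "continuous_on UNIV f" "continuous_on UNIV g"
  shows "fmode n (\<lambda>z. f z + g z) c r = fmode n f c r + fmode n g c r"
  unfolding fmode_def using fmode_integrable[OF assms(1)] fmode_integrable[OF assms(2)]
  by (simp add: algebra_simps integral_add add_divide_distrib)

lemma fmode_cnj: "fmode n (\<lambda>z. cnj (f z)) c r = cnj (fmode (- n) f c r)"
proof -
  have "integral {0..2*pi} (\<lambda>t. cnj (f (c + of_real r * cis t)) * cis (- of_int n * t)) =
     integral {0..2*pi} (\<lambda>t. cnj (f (c + of_real r * cis t) * cis (- of_int (-n) * t)))"
    by (simp add: cis_cnj)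
  then show ?thesis by (simp add: fmode_def integral_cnj)
qed

lemma cis_has_vector_derivative:
  "((\<lambda>t. cis (k * t)) has_vector_derivative \<i> * of_real k * cis (k * t)) (at t)"
proof -
  have "((\<lambda>t. exp (\<i> * of_real k * of_real t)) has_vector_derivative (\<i> * of_real k) * exp (\<i> * of_real k * of_real t)) (at t)"
  proof -
    have "((\<lambda>w. exp (\<i> * of_real k * w)) has_field_derivative (\<i> * of_real k) * exp (\<i> * of_real k * of_real t)) (at (of_real t))"
      by (auto intro!: derivative_eq_intros)
    from has_field_derivative_at_within[OF this] show ?thesis
      by (rule has_vector_derivative_real_field)
  qed
  then show ?thesis by (simp add: cis_conv_exp mult.assoc)
qed

lemma fmode_const:
  assumes "n \<noteq> 0" shows "fmode n (\<lambda>z. k) c r = 0"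
proof -
  have "((\<lambda>t. \<i> * of_real (- of_int n) * cis (- of_int n * t)) has_integral cis (- of_int n * (2 * pi)) - cis (- of_int n * 0)) {0..2*pi}"
    by (rule fundamental_theorem_of_calculus, simp, rule has_vector_derivative_at_within,
        rule cis_has_vector_derivative)
  moreover have "cis (- of_int n * (2 * pi)) = 1"
    using cis_multiple_2pi[of "- of_int n"] by (simp add: mult.commute)
  ultimately have "((\<lambda>t. \<i> * of_real (- of_int n) * cis (- of_int n * t)) has_integral 0) {0..2*pi}" by simp
  from has_integral_mult_right[OF this, of "k / (\<i> * of_real (- of_int n))"]
  have "((\<lambda>t. k * cis (- of_int n * t)) has_integral 0) {0..2*pi}"
    using assms by simp
  from integral_unique[OF this] show ?thesis by (simp add: fmode_def)
qed

lemma fmode_at_0: "fmode 0 f c 0 = f c"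
  by (simp add: fmode_def scaleR_conv_of_real)

text \<open>The radial and the angular derivative of f on a circle are the two combinations of its Wirtinger
  derivatives. Averaging the first gives the r-derivative of a mode; averaging the second, which is a total
  derivative in the angle, gives the mode itself. Eliminating the mode of \<open>a\<close> between the two identities leaves
  an equation in which only the conjugate derivative \<open>b\<close> appears: \<open>r^(-n)\<close> times the n-th mode of f has
  derivative \<open>2 r^(-n)\<close> times the (n+1)-st mode of \<open>b\<close>.\<close>

lemma fmode_radial:
  assumes f: "\<And>z. wirtinger f (a z) (b z) z" and a: "continuous_on UNIV a" and b: "continuous_on UNIV b"
  shows "(fmode n f c has_vector_derivative fmode (n - 1) a c r + fmode (n + 1) b c r) (at r)"
proof -
  have cf: "continuous_on UNIV f" using f by (rule wirtinger_continuous)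
  have eq: "(a z * cis t + b z * cnj (cis t)) * cis (- of_int n * t) =
      a z * cis (- of_int (n - 1) * t) + b z * cis (- of_int (n + 1) * t)" for z t
    by (simp add: algebra_simps cis_cnj cis_mult)
  have "((\<lambda>r. integral (cbox 0 (2*pi)) (\<lambda>t. f (c + of_real r * cis t) * cis (- of_int n * t)))
      has_vector_derivative integral (cbox 0 (2*pi)) (\<lambda>t. a (c + of_real r * cis t) * cis (- of_int (n - 1) * t) + b (c + of_real r * cis t) * cis (- of_int (n + 1) * t)))
       (at r within UNIV)"
  proof (rule leibniz_rule_vector_derivative)
    fix r t
    have l: "((\<lambda>r. c + of_real r * cis t) has_vector_derivative cis t) (at r)"
      by (auto intro!: derivative_eq_intros simp: has_vector_derivative_def scaleR_conv_of_real)
    have "((\<lambda>r. f (c + of_real r * cis t) * cis (- of_int n * t)) has_vector_derivative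
        (a (c + of_real r * cis t) * cis t + b (c + of_real r * cis t) * cnj (cis t)) * cis (- of_int n * t)) (at r)"
      by (rule has_vector_derivative_mult_left[OF wirtinger_path[OF f l]])
    then show "((\<lambda>r. f (c + of_real r * cis t) * cis (- of_int n * t)) has_vector_derivative
        a (c + of_real r * cis t) * cis (- of_int (n - 1) * t) + b (c + of_real r * cis t) * cis (- of_int (n + 1) * t)) (at r within UNIV)"
      by (simp only: eq)
  next
    show "(\<lambda>t. f (c + of_real r * cis t) * cis (- of_int n * t)) integrable_on cbox 0 (2 * pi)" for r
      using fmode_integrable[OF cf] by simp
    show "continuous_on (UNIV \<times> cbox 0 (2 * pi)) (\<lambda>(r, t). a (c + of_real r * cis t) * cis (- of_int (n - 1) * t) + b (c + of_real r * cis t) * cis (- of_int (n + 1) * t))"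
      unfolding split_beta
      by (intro continuous_intros continuous_on_cis continuous_on_compose2[OF a] continuous_on_compose2[OF b]) auto
  qed auto
  from has_vector_derivative_divide[OF this[unfolded cbox_interval], of "of_real (2 * pi)"]
  have "((\<lambda>r. integral {0..2*pi} (\<lambda>t. f (c + of_real r * cis t) * cis (- of_int n * t)) / of_real (2 * pi))
      has_vector_derivative integral {0..2*pi} (\<lambda>t. a (c + of_real r * cis t) * cis (- of_int (n - 1) * t) + b (c + of_real r * cis t) * cis (- of_int (n + 1) * t)) / of_real (2 * pi)) (at r)"
    by (simp only: simp_thms)
  also have "integral {0..2*pi} (\<lambda>t. a (c + of_real r * cis t) * cis (- of_int (n - 1) * t) + b (c + of_real r * cis t) * cis (- of_int (n + 1) * t)) =
      integral {0..2*pi} (\<lambda>t. a (c + of_real r * cis t) * cis (- of_int (n - 1) * t)) + integral {0..2*pi} (\<lambda>t. b (c + of_real r * cis t) * cis (- of_int (n + 1) * t))"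
    by (intro integral_add fmode_integrable a b)
  finally show ?thesis unfolding fmode_def[abs_def] add_divide_distrib .
qed

lemma fmode_angular:
  assumes f: "\<And>z. wirtinger f (a z) (b z) z" and a: "continuous_on UNIV a" and b: "continuous_on UNIV b"
  shows "of_int n * fmode n f c r = of_real r * (fmode (n - 1) a c r - fmode (n + 1) b c r)"
proof -
  have cf: "continuous_on UNIV f" using f by (rule wirtinger_continuous)
  define A B E where "A = integral {0..2*pi} (\<lambda>t. a (c + of_real r * cis t) * cis (- of_int (n - 1) * t))"
    and "B = integral {0..2*pi} (\<lambda>t. b (c + of_real r * cis t) * cis (- of_int (n + 1) * t))"
    and "E = integral {0..2*pi} (\<lambda>t. f (c + of_real r * cis t) * cis (- of_int n * t))"
  let ?D = "\<lambda>t. \<i> * of_real r * (a (c + of_real r * cis t) * cis (- of_int (n - 1) * t))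
      - \<i> * of_real r * (b (c + of_real r * cis t) * cis (- of_int (n + 1) * t))
      - \<i> * of_int n * (f (c + of_real r * cis t) * cis (- of_int n * t))"
  let ?g = "\<lambda>t. f (c + of_real r * cis t) * cis (- of_int n * t)"
  have "(?D has_integral (?g (2*pi) - ?g 0)) {0..2*pi}"
  proof (rule fundamental_theorem_of_calculus, simp, rule has_vector_derivative_at_within)
    fix t :: real
    have "((\<lambda>t. cis t) has_vector_derivative \<i> * cis t) (at t)"
      using cis_has_vector_derivative[of 1 t] by simp
    then have l: "((\<lambda>t. c + of_real r * cis t) has_vector_derivative of_real r * (\<i> * cis t)) (at t)"
      by (auto intro!: derivative_eq_intros)
    have eq: "a z * (of_real r * (\<i> * cis t)) + b z * cnj (of_real r * (\<i> * cis t)) =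
        \<i> * of_real r * (a z * cis t - b z * cis (-t))" for z
      by (simp add: algebra_simps cis_cnj)
    have "((\<lambda>t. f (c + of_real r * cis t)) has_vector_derivative
       \<i> * of_real r * (a (c + of_real r * cis t) * cis t - b (c + of_real r * cis t) * cis (-t))) (at t)"
      using wirtinger_path[OF f l] unfolding eq .
    from has_vector_derivative_mult[OF this cis_has_vector_derivative[of "- of_int n" t]]
    show "(?g has_vector_derivative ?D t) (at t)"
    proof (rule has_vector_derivative_eq_rhs)
      have c: "cis (- of_int (n - 1) * t) = cis t * cis (- of_int n * t)"
        "cis (- of_int (n + 1) * t) = cis (- t) * cis (- of_int n * t)"
        by (simp_all add: cis_mult algebra_simps)
      show "f (c + of_real r * cis t) * (\<i> * of_real (- of_int n) * cis (- of_int n * t)) +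
          \<i> * of_real r * (a (c + of_real r * cis t) * cis t - b (c + of_real r * cis t) * cis (- t)) *
          cis (- of_int n * t) = ?D t"
        unfolding c by (simp add: algebra_simps)
    qed
  qed
  moreover have "cis (- of_int n * (2 * pi)) = 1"
    using cis_multiple_2pi[of "- of_int n"] by (simp add: mult.commute)
  ultimately have "(?D has_integral 0) {0..2*pi}" by simp
  moreover have "(?D has_integral \<i> * of_real r * A - \<i> * of_real r * B - \<i> * of_int n * E) {0..2*pi}"
    unfolding A_def B_def E_def
    by (intro has_integral_diff has_integral_mult_right integrable_integral fmode_integrable a b cf)
  ultimately have "\<i> * of_real r * A - \<i> * of_real r * B - \<i> * of_int n * E = 0"
    by (rule has_integral_unique[rotated])
  moreover have "\<i> * of_real r * A - \<i> * of_real r * B - \<i> * of_int n * E =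
      \<i> * (of_real r * (A - B)) - \<i> * (of_int n * E)"
    by (simp only: right_diff_distrib mult.assoc)
  ultimately have "\<i> * (of_int n * E) = \<i> * (of_real r * (A - B))" by simp
  then have "of_int n * E = of_real r * (A - B)"
    by (subst (asm) mult_left_cancel) (rule complex_i_not_zero)
  then have "of_int n * (E / of_real (2 * pi)) = of_real r * (A / of_real (2 * pi) - B / of_real (2 * pi))"
    by (metis (no_types) diff_divide_distrib times_divide_eq_right)
  then show ?thesis unfolding fmode_def A_def B_def E_def .
qed

section \<open>Estimates for Fourier modes\<close>

lemma vector_derivative_bound:
  fixes f :: "real \<Rightarrow> complex"
  assumes "x \<le> y" "\<And>s. s \<in> {x..y} \<Longrightarrow> (f has_vector_derivative f' s) (at s)"
    "\<And>s. s \<in> {x..y} \<Longrightarrow> norm (f' s) \<le> K"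
  shows "norm (f y - f x) \<le> K * (y - x)"
proof -
  have "norm (f y - f x) \<le> K * norm (y - x)"
  proof (rule differentiable_bound[of "{x..y}" f "\<lambda>s h. h *\<^sub>R f' s"])
    fix s assume s: "s \<in> {x..y}"
    show "(f has_derivative (\<lambda>h. h *\<^sub>R f' s)) (at s within {x..y})"
      using assms(2)[OF s] unfolding has_vector_derivative_def by (rule has_derivative_at_withinI)
    show "onorm (\<lambda>h. h *\<^sub>R f' s) \<le> K"
      using assms(3)[OF s] by (intro onorm_le) (simp add: mult.commute[of K] mult_left_mono)
  qed (use assms in auto)
  then show ?thesis using assms by simp
qed

lemma fmode_at_centre: "n \<noteq> 0 \<Longrightarrow> fmode n f c 0 = 0"
  using fmode_const[of n "f c" c 0] by (simp add: fmode_def)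

text \<open>For a negative mode the quantity \<open>r^m\<close> times the mode vanishes at r = 0, so integrating its derivative
  \<open>2 r^m fmode (1 - m) b\<close> from the centre bounds it by the conjugate derivative alone. This is the sense in
  which negative modes measure the failure of f to be holomorphic.\<close>

lemma fmode_negative_bound:
  assumes f: "\<And>z. wirtinger f (a z) (b z) z" and a: "continuous_on UNIV a" and b: "continuous_on UNIV b"
    and m: "m \<ge> 1" and r: "r \<ge> 0" and K: "\<And>s. 0 \<le> s \<Longrightarrow> s \<le> r \<Longrightarrow> norm (fmode (1 - int m) b c s) \<le> K"
  shows "norm (fmode (- int m) f c r) \<le> 2 * K * r"
proof (cases "r = 0")
  case True
  then show ?thesis using m by (simp add: fmode_at_centre)
next
  case False
  then have r0: "r > 0" using r by simp
  let ?G = "\<lambda>s. of_real (s ^ m) * fmode (- int m) f c s"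
  have "norm (?G r - ?G 0) \<le> (2 * K * r ^ m) * (r - 0)"
  proof (rule vector_derivative_bound)
    fix s assume s: "s \<in> {0..r}"
    obtain k where k: "m = Suc k" using m by (cases m) auto
    have pw: "((\<lambda>s. of_real (s ^ m)) has_vector_derivative (of_real (real m * s ^ k) :: complex)) (at s)"
      using DERIV_pow[of m s UNIV] by (intro has_vector_derivative_of_real) (simp add: k)
    have ang: "- of_nat m * fmode (- int m) f c s
        = of_real s * (fmode (- int m - 1) a c s - fmode (1 - int m) b c s)"
      using fmode_angular[OF f a b, of "- int m" c s] by (simp add: add.commute)
    have rad: "(fmode (- int m) f c has_vector_derivative
        (fmode (- int m - 1) a c s + fmode (1 - int m) b c s)) (at s)"
      using fmode_radial[OF f a b, of "- int m" c s] by (simp add: add.commute)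
    have eq: "of_real (s ^ m) * (X + Y) + of_real (real m * s ^ k) * Z = 2 * of_real (s ^ m) * Y"
      if "- of_nat m * Z = of_real s * (X - Y)" for X Y Z :: complex
    proof -
      have "of_real (real m * s ^ k) * Z = - (of_real (s ^ k) * (- of_nat m * Z))" by simp
      also have "\<dots> = - (of_real (s ^ m) * (X - Y))" unfolding that by (simp add: k)
      finally show ?thesis by (simp add: algebra_simps)
    qed
    show "(?G has_vector_derivative 2 * of_real (s ^ m) * fmode (1 - int m) b c s) (at s)"
      using has_vector_derivative_mult[OF pw rad] unfolding eq[OF ang] .
    have "s ^ m * norm (fmode (1 - int m) b c s) \<le> r ^ m * K"
      using s by (intro mult_mono K power_mono) auto
    then show "norm (2 * of_real (s ^ m) * fmode (1 - int m) b c s) \<le> 2 * K * r ^ m"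
      using s by (simp add: norm_mult norm_power algebra_simps)
  qed (use r in auto)
  then have "r ^ m * norm (fmode (- int m) f c r) \<le> r ^ m * (2 * K * r)"
    using r m by (simp add: norm_mult norm_power algebra_simps zero_power)
  then show ?thesis using r0 by simp
qed

text \<open>Up to an error caused by \<open>b\<close>, the first mode is r times the z-derivative at the centre, as for a
  holomorphic function: the quotient \<open>fmode 1 f c r / r\<close> has derivative \<open>2 fmode 2 b c r / r\<close> and tends to
  \<open>a c\<close> at the centre. Bounds on the first mode thus become bounds on a derivative.\<close>

lemma fmode_1_approx:
  assumes f: "\<And>z. wirtinger f (a z) (b z) z" and a: "continuous_on UNIV a" and b: "continuous_on UNIV b"
    and r: "r > 0" and K: "\<And>s. 0 \<le> s \<Longrightarrow> s \<le> r \<Longrightarrow> norm (fmode 2 b c s) \<le> K * s"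
  shows "norm (fmode 1 f c r / of_real r - a c) \<le> 2 * K * r"
proof -
  have K0: "K \<ge> 0" using K[of r] r norm_ge_zero[of "fmode 2 b c r"]
    by (metis order_trans less_imp_le order_refl zero_le_mult_iff not_less)
  let ?G = "\<lambda>s. fmode 1 f c s / of_real s"
  have rad: "(fmode 1 f c has_vector_derivative (fmode 0 a c s + fmode 2 b c s)) (at s)" for s
    using fmode_radial[OF f a b, of 1 c s] by simp
  have close: "norm (?G r - ?G e) \<le> 2 * K * r" if e: "e > 0" "e < r" for e
  proof -
    have "norm (?G r - ?G e) \<le> (2 * K) * (r - e)"
    proof (rule vector_derivative_bound)
      fix s assume s: "s \<in> {e..r}"
      then have s0: "s > 0" using e by simp
      have ang: "fmode 1 f c s = of_real s * (fmode 0 a c s - fmode 2 b c s)"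
        using fmode_angular[OF f a b, of 1 c s] by simp
      have inv: "((\<lambda>s. of_real (inverse s)) has_vector_derivative (of_real (- inverse (s^2)) :: complex)) (at s)"
        using s0 by (intro has_vector_derivative_of_real)
          (auto intro!: derivative_eq_intros simp: power2_eq_square)
      have "fmode 1 f c s * of_real (- inverse (s^2)) + (fmode 0 a c s + fmode 2 b c s) * of_real (inverse s)
          = 2 * fmode 2 b c s / of_real s"
        unfolding ang using s0 by (simp add: field_simps power2_eq_square)
      with has_vector_derivative_mult[OF rad inv]
      have "((\<lambda>s. fmode 1 f c s * of_real (inverse s)) has_vector_derivative 2 * fmode 2 b c s / of_real s) (at s)"
        by metis
      then show "(?G has_vector_derivative 2 * fmode 2 b c s / of_real s) (at s)"
        by (simp add: divide_inverse)
      have "norm (fmode 2 b c s) \<le> K * s" using s s0 by (intro K) auto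
      then show "norm (2 * fmode 2 b c s / of_real s) \<le> 2 * K"
        using s0 by (simp add: norm_mult norm_divide field_simps)
    qed (use e in auto)
    also have "\<dots> \<le> 2 * K * r" using e K0 by (intro mult_left_mono) auto
    finally show ?thesis .
  qed
  have "(?G \<longlongrightarrow> a c) (at 0)"
  proof -
    have "(fmode 1 f c has_vector_derivative a c) (at 0)"
      using rad[of 0] by (simp add: fmode_at_0 fmode_at_centre)
    then have "((\<lambda>h. norm (fmode 1 f c h - of_real h * a c) / norm h) \<longlongrightarrow> 0) (at 0)"
      by (simp add: has_vector_derivative_def has_derivative_at fmode_at_centre scaleR_conv_of_real)
    moreover have "eventually (\<lambda>h. norm (fmode 1 f c h - of_real h * a c) / norm h = norm (?G h - a c)) (at 0)"
    proof -
      have "norm (fmode 1 f c h - of_real h * a c) / norm h = norm (?G h - a c)" if "h \<noteq> 0" for h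
      proof -
        have "?G h - a c = (fmode 1 f c h - of_real h * a c) / of_real h" using that by (simp add: field_simps)
        then show ?thesis by (simp add: norm_divide)
      qed
      then show ?thesis unfolding eventually_at_filter by (intro always_eventually) blast
    qed
    ultimately have "((\<lambda>h. norm (?G h - a c)) \<longlongrightarrow> 0) (at 0)"
      by (rule Lim_transform_eventually)
    then show ?thesis
      using tendsto_norm_zero_iff LIM_zero_iff by blast
  qed
  then have lim: "(?G \<longlongrightarrow> a c) (at_right 0)"
    by (rule filterlim_mono) (auto simp: at_le)
  have "((\<lambda>e. norm (?G r - ?G e)) \<longlongrightarrow> norm (?G r - a c)) (at_right 0)"
    by (intro tendsto_intros lim)
  moreover have "eventually (\<lambda>e. norm (?G r - ?G e) \<le> 2 * K * r) (at_right 0)"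
    using r close unfolding eventually_at_right_field by blast
  ultimately show ?thesis
    by (intro tendsto_upperbound) auto
qed

text \<open>All modes of a nonnegative function are dominated by its mean. This is where boundedness of u from one
  side only becomes a two-sided estimate.\<close>

lemma fmode_nonneg_bound:
  fixes g :: "complex \<Rightarrow> real"
  assumes "continuous_on UNIV g" "\<And>z. g z \<ge> 0"
  shows "norm (fmode n (\<lambda>z. of_real (g z)) c r) \<le> Re (fmode 0 (\<lambda>z. of_real (g z)) c r)"
proof -
  have ci: "(\<lambda>t. g (c + of_real r * cis t)) integrable_on {0..2*pi}"
    by (intro integrable_continuous_real continuous_on_compose2[OF assms(1)] continuous_intros) auto
  have cg: "continuous_on UNIV (\<lambda>z. complex_of_real (g z))" by (intro continuous_intros assms)
  have "norm (integral {0..2*pi} (\<lambda>t. of_real (g (c + of_real r * cis t)) * cis (- of_int n * t)))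
     \<le> integral {0..2*pi} (\<lambda>t. g (c + of_real r * cis t))"
    using assms(2) by (intro integral_norm_bound_integral fmode_integrable[OF cg] ci) (auto simp: norm_mult)
  moreover have "integral {0..2*pi} (\<lambda>t. complex_of_real (g (c + of_real r * cis t))) =
      of_real (integral {0..2*pi} (\<lambda>t. g (c + of_real r * cis t)))"
    using has_integral_of_real[OF integrable_integral[OF ci]] by (rule integral_unique)
  ultimately show ?thesis
    by (simp add: fmode_def norm_divide divide_right_mono flip: of_real_mult of_real_divide)
qed

section \<open>The Schwarzian of a solution is entire\<close>

text \<open>A solution together with \<open>p = u_z\<close> and \<open>q = u_zz - (u_z)^2\<close>. Only p is differentiated here, never q, so
  that two continuous derivatives of u suffice.\<close>

locale liouville_field =
  fixes u :: "complex \<Rightarrow> real" and p q :: "complex \<Rightarrow> complex"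
  assumes du: "wirtinger (\<lambda>z. of_real (u z)) (p z) (cnj (p z)) z"
    and dp: "wirtinger p (q z + (p z)\<^sup>2) (- exp (2 * of_real (u z)) / 4) z"
    and cont_q: "continuous_on UNIV q"
begin

lemma dexp: "wirtinger (\<lambda>z. exp (k * of_real (u z))) (exp (k * of_real (u z)) * (k * p z))
   (exp (k * of_real (u z)) * (k * cnj (p z))) z"
  by (intro wirtinger_exp wirtinger_cmult du)

lemma cont_u: "continuous_on S u"
proof -
  have "continuous_on S (\<lambda>z. Re (of_real (u z)))"
    by (intro continuous_on_Re wirtinger_continuous[OF du])
  then show ?thesis by simp
qed

lemma cont_p: "continuous_on S p"
  using dp by (rule wirtinger_continuous)

lemma cont_e: "continuous_on S (\<lambda>z. - exp (2 * complex_of_real (u z)) / 4)"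
  by (intro continuous_intros cont_u) auto

lemma cont_pz: "continuous_on UNIV (\<lambda>z. q z + (p z)\<^sup>2)"
  by (intro continuous_intros cont_q cont_p)

text \<open>No third derivative of u is available, so q cannot be differentiated directly. Instead, the form with
  coefficients \<open>-p^2\<close> and \<open>exp (2 u) / 4\<close> is closed by the Liouville equation. Adding a primitive of it to p
  cancels the conjugate derivative and leaves q as z-derivative, so q is the complex derivative of an entire
  function.\<close>

lemma holomorphic_q: "q holomorphic_on UNIV"
proof -
  let ?E = "\<lambda>z. exp (2 * complex_of_real (u z))"
  have F: "wirtinger (\<lambda>z. 1 / 4 * ?E z) (?E z * p z / 2) (?E z * cnj (p z) / 2) z" for z
    using wirtinger_cmult[OF dexp[of 2 z], of "1/4"] by (simp add: algebra_simps)
  have G: "wirtinger (\<lambda>z. - (p z * p z)) (- (2 * p z * (q z + (p z)\<^sup>2))) (?E z * p z / 2) z" for z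
    using wirtinger_minus[OF wirtinger_mult[OF dp[of z] dp[of z]]] by (simp add: algebra_simps)
  obtain P where P: "\<And>z. wirtinger P (- (p z * p z)) (1 / 4 * ?E z) z"
  proof (rule closed_form_exact[OF F G, rotated 3])
    show "continuous_on UNIV (\<lambda>z. ?E z * p z / 2)" "continuous_on UNIV (\<lambda>z. ?E z * cnj (p z) / 2)"
      "continuous_on UNIV (\<lambda>z. - (2 * p z * (q z + (p z)\<^sup>2)))"
      by (intro continuous_intros cont_u cont_p cont_q; simp)+
  qed blast
  have "((\<lambda>z. p z + P z) has_field_derivative q z) (at z)" for z
    using wirtinger_add[OF dp P, of z] unfolding wirtinger_holo by (simp add: power2_eq_square)
  then have h: "(\<lambda>z. p z + P z) holomorphic_on UNIV" and d: "deriv (\<lambda>z. p z + P z) = q"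
    by (auto simp: holomorphic_on_def field_differentiable_def intro: DERIV_imp_deriv)
  from holomorphic_deriv[OF h] show ?thesis by (simp add: d)
qed

end

section \<open>Growth of solutions bounded above\<close>

locale bounded_liouville_field = liouville_field +
  fixes M :: real
  assumes u_le: "u z \<le> M"
begin

definition B :: real where "B = exp (2 * M)"

lemma B_pos: "B > 0" by (simp add: B_def)

lemma e_bound: "norm (- exp (2 * complex_of_real (u z)) / 4) \<le> B / 4"
proof -
  have "norm (exp (2 * complex_of_real (u z))) = exp (2 * u z)"
    by simp
  then show ?thesis using u_le[of z] by (simp add: norm_divide B_def)
qed

text \<open>The conjugate derivative of p is bounded, hence so are the negative modes of p divided by the radius.
  These two modes are the inhomogeneities in the equations for the modes 0 and 1 of u.\<close>

lemma mode_bounds: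
  assumes "r \<ge> 0"
  shows "norm (fmode (-1) p c r) \<le> B / 2 * r" "norm (fmode (-2) p c r) \<le> B / 2 * r"
proof -
  note b = fmode_bound[OF cont_e, of c _ "B/4"]
  show "norm (fmode (-1) p c r) \<le> B / 2 * r"
    using fmode_negative_bound[OF dp cont_pz cont_e, of 1 r c "B/4"] b e_bound assms by simp
  show "norm (fmode (-2) p c r) \<le> B / 2 * r"
    using fmode_negative_bound[OF dp cont_pz cont_e, of 2 r c "B/4"] b e_bound assms by simp
qed

lemma mean_bound:
  assumes "r \<ge> 0"
  shows "norm (fmode 0 (\<lambda>z. of_real (u z)) c r - of_real (u c)) \<le> B * r\<^sup>2"
proof -
  let ?U = "\<lambda>z. complex_of_real (u z)"
  have cp': "continuous_on UNIV (\<lambda>z. cnj (p z))" by (intro continuous_intros cont_p)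
  have "norm (fmode 0 ?U c r - fmode 0 ?U c 0) \<le> (B * r) * (r - 0)"
  proof (rule vector_derivative_bound[OF assms])
    fix s assume s: "s \<in> {0..r}"
    show "(fmode 0 ?U c has_vector_derivative (fmode (-1) p c s + cnj (fmode (-1) p c s))) (at s)"
      using fmode_radial[OF du cont_p cp', of 0 c s] fmode_cnj[of 1 p c s] by simp
    have "norm (fmode (-1) p c s + cnj (fmode (-1) p c s)) \<le> B / 2 * s + B / 2 * s"
      using mode_bounds(1)[of s c] s by (intro norm_triangle_mono) auto
    also have "\<dots> \<le> B * r" using s B_pos by simp
    finally show "norm (fmode (-1) p c s + cnj (fmode (-1) p c s)) \<le> B * r" .
  qed
  then show ?thesis by (simp add: fmode_at_0 power2_eq_square mult.assoc)
qed

text \<open>A Harnack-type gradient estimate valid at every scale r. The first mode of u equals, up to sign, that of the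
  nonnegative function \<open>M - u\<close>, which is at most the mean of \<open>M - u\<close>, and this mean is at most
  \<open>M - u c + B r^2\<close>.\<close>

lemma gradient_scale:
  assumes r: "r > 0"
  shows "norm (p c) \<le> (M - u c) / r + 2 * B * r"
proof -
  let ?U = "\<lambda>z. complex_of_real (u z)" and ?V = "\<lambda>z. complex_of_real (M - u z)"
  have cp': "continuous_on UNIV (\<lambda>z. cnj (p z))" by (intro continuous_intros cont_p)
  have cU: "continuous_on UNIV ?U" by (intro continuous_intros cont_u)
  have "norm (fmode 1 ?U c r / of_real r - p c) \<le> 2 * (B / 2) * r"
  proof (rule fmode_1_approx[OF du cont_p cp' r])
    fix s :: real assume "0 \<le> s" "s \<le> r"
    then show "norm (fmode 2 (\<lambda>z. cnj (p z)) c s) \<le> B / 2 * s"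
      using mode_bounds(2)[of s c] by (simp add: fmode_cnj)
  qed
  then have 1: "norm (p c) \<le> norm (fmode 1 ?U c r) / r + B * r"
    using norm_triangle_sub[of "p c" "fmode 1 ?U c r / of_real r"] r
    by (simp add: norm_minus_commute norm_divide)
  have lin: "fmode n ?U c r = fmode n (\<lambda>z. of_real M) c r - fmode n ?V c r" for n
    using fmode_add[OF cU, of ?V n c r] by (simp add: continuous_intros cont_u)
  have "norm (fmode 1 ?U c r) = norm (fmode 1 ?V c r)"
    unfolding lin by (simp add: fmode_const)
  also have "\<dots> \<le> Re (fmode 0 ?V c r)"
    using u_le by (intro fmode_nonneg_bound continuous_intros cont_u) (auto simp: algebra_simps)
  also have "\<dots> = M - Re (fmode 0 ?U c r)"
    unfolding lin by (simp add: fmode_def scaleR_conv_of_real)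
  also have "\<dots> \<le> M - u c + B * r\<^sup>2"
    using mean_bound[of r c] r abs_Re_le_cmod[of "fmode 0 ?U c r - of_real (u c)"] by simp
  finally have "norm (fmode 1 ?U c r) / r \<le> (M - u c + B * r\<^sup>2) / r"
    using r by (intro divide_right_mono) auto
  then show ?thesis using 1 r by (simp add: field_simps power2_eq_square)
qed

text \<open>The shift by 1 keeps the radicand away from 0, so that \<open>height\<close> is differentiable and can be used as a
  divisor.\<close>

definition height :: "complex \<Rightarrow> real" where "height z = sqrt (M + 1 - u z)"

lemma height_ge_1: "height z \<ge> 1"
  using u_le[of z] by (simp add: height_def)

text \<open>The two terms of \<open>gradient_scale\<close> balance at \<open>r = height z / sqrt B\<close>.\<close>

lemma gradient_bound: "norm (p z) \<le> 3 * sqrt B * height z"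
proof -
  have sB: "sqrt B > 0" and h: "height z > 0" using B_pos height_ge_1[of z] by auto
  have "norm (p z) \<le> (M - u z) / (height z / sqrt B) + 2 * B * (height z / sqrt B)"
    using sB h by (intro gradient_scale) auto
  also have "\<dots> \<le> (height z)\<^sup>2 / (height z / sqrt B) + 2 * B * (height z / sqrt B)"
    using sB h u_le[of z] by (intro add_right_mono divide_right_mono) (auto simp: height_def)
  also have "(height z)\<^sup>2 / (height z / sqrt B) = sqrt B * height z"
    using sB h by (simp add: power2_eq_square)
  also have "2 * B * (height z / sqrt B) = 2 * (B / sqrt B) * height z" by simp
  also have "B / sqrt B = sqrt B" using B_pos by (simp add: real_div_sqrt)
  finally show ?thesis by simp
qed

lemma u_path:
  assumes "(g has_vector_derivative d) (at t)"
  shows "((\<lambda>t. u (g t)) has_real_derivative 2 * Re (p (g t) * d)) (at t)"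
proof -
  have "((\<lambda>t. Re (of_real (u (g t)))) has_vector_derivative Re (p (g t) * d + cnj (p (g t)) * cnj d)) (at t)"
    using wirtinger_path[OF du assms] by (intro bounded_linear.has_vector_derivative[OF bounded_linear_Re])
  then show ?thesis by (simp add: has_real_derivative_iff_has_vector_derivative mult.commute)
qed

text \<open>The gradient of \<open>height\<close> is that of u divided by twice the height, hence bounded by \<open>gradient_bound\<close>.\<close>

lemma height_growth: "height z \<le> height 0 + 3 * sqrt B * norm z"
proof -
  have "norm (height (of_real 1 * z) - height (of_real 0 * z)) \<le> (3 * sqrt B * norm z) * norm (1 - (0::real))"
  proof (rule field_differentiable_bound[of "UNIV :: real set"])
    fix t :: real
    have l: "((\<lambda>t. of_real t * z) has_vector_derivative z) (at t)"
      by (auto intro!: derivative_eq_intros simp: has_vector_derivative_def scaleR_conv_of_real)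
    have pos: "M + 1 - u (of_real t * z) > 0" using u_le[of "of_real t * z"] by simp
    show "((\<lambda>t. height (of_real t * z)) has_real_derivative
       (- (2 * Re (p (of_real t * z) * z)) * (inverse (height (of_real t * z)) / 2))) (at t)"
      unfolding height_def using pos
      by (auto intro!: derivative_eq_intros u_path[OF l])
    have "\<bar>Re (p (of_real t * z) * z)\<bar> \<le> norm (p (of_real t * z)) * norm z"
      by (metis abs_Re_le_cmod norm_mult)
    also have "\<dots> \<le> 3 * sqrt B * height (of_real t * z) * norm z"
      by (intro mult_right_mono gradient_bound) auto
    finally show "norm (- (2 * Re (p (of_real t * z) * z)) * (inverse (height (of_real t * z)) / 2)) \<le> 3 * sqrt B * norm z"
      using height_ge_1[of "of_real t * z"] by (simp add: abs_mult field_simps)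
  qed auto
  then show ?thesis by simp
qed

lemma p_growth: "\<exists>C. \<forall>z. norm (p z) \<le> C * (1 + norm z)"
proof (intro exI allI)
  fix z
  have h: "height 0 \<ge> 0" "sqrt B \<ge> 0" using height_ge_1[of 0] B_pos by auto
  have "norm (p z) \<le> 3 * sqrt B * (height 0 + 3 * sqrt B * norm z)"
    using gradient_bound[of z] height_growth[of z] h
    by (meson mult_left_mono order_trans mult_nonneg_nonneg zero_le_numeral)
  also have "\<dots> \<le> 3 * sqrt B * ((height 0 + 3 * sqrt B) * (1 + norm z))"
    using h by (intro mult_left_mono) (auto simp: algebra_simps)
  finally show "norm (p z) \<le> 3 * sqrt B * (height 0 + 3 * sqrt B) * (1 + norm z)"
    by (simp add: mult.assoc)
qed

text \<open>The first mode of p on the unit circle around c is at most P and approximates \<open>p_z = q + p^2\<close> at c. The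
  error comes from the second mode of \<open>exp (2 u)\<close>; constants have no second mode, and the gradient of
  \<open>exp (2 u)\<close> is again controlled by p, so the error is linear in P as well.\<close>

lemma p_z_bound:
  assumes P: "\<And>z. z \<in> cball c 1 \<Longrightarrow> norm (p z) \<le> P"
  shows "norm (q c + (p c)\<^sup>2) \<le> (1 + 2 * B) * P"
proof -
  define e where "e = (\<lambda>z. - exp (2 * complex_of_real (u z)) / 4)"
  have de: "wirtinger e (2 * e z * p z) (2 * e z * cnj (p z)) z" for z
    using wirtinger_cmult[OF dexp[of 2 z], of "-1/4"] by (simp add: e_def algebra_simps)
  have P0: "P \<ge> 0" by (rule order_trans[OF norm_ge_zero P[of c]]) simp
  have lip: "norm (e z - e c) \<le> B * P * norm (z - c)" if "z \<in> cball c 1" for z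
  proof (rule differentiable_bound[of "cball c 1" e "\<lambda>z h. 2 * e z * p z * h + 2 * e z * cnj (p z) * cnj h"])
    fix w assume w: "w \<in> cball c 1"
    show "(e has_derivative (\<lambda>h. 2 * e w * p w * h + 2 * e w * cnj (p w) * cnj h)) (at w within cball c 1)"
      using de[of w, unfolded wirtinger_def] by (rule has_derivative_at_withinI)
    have ep: "norm (e w) * norm (p w) \<le> B / 4 * P"
      using e_bound[of w] P[OF w] B_pos by (intro mult_mono) (auto simp: e_def)
    show "onorm (\<lambda>h. 2 * e w * p w * h + 2 * e w * cnj (p w) * cnj h) \<le> B * P"
    proof (rule onorm_le)
      fix h
      have "norm (2 * e w * p w * h + 2 * e w * cnj (p w) * cnj h)
        \<le> 2 * (norm (e w) * norm (p w)) * norm h + 2 * (norm (e w) * norm (p w)) * norm h"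
        by (rule norm_triangle_le) (simp add: norm_mult)
      also have "\<dots> = 4 * (norm (e w) * norm (p w)) * norm h" by simp
      also have "\<dots> \<le> B * P * norm h"
        using ep by (intro mult_right_mono) auto
      finally show "norm (2 * e w * p w * h + 2 * e w * cnj (p w) * cnj h) \<le> B * P * norm h" .
    qed
  qed (use that in auto)
  have dpe: "wirtinger p (q z + (p z)\<^sup>2) (e z) z" for z using dp[of z] by (simp add: e_def)
  have ce: "continuous_on UNIV e" unfolding e_def by (rule cont_e)
  have "norm (fmode 1 p c 1 / of_real 1 - (q c + (p c)\<^sup>2)) \<le> 2 * (B * P) * 1"
  proof (rule fmode_1_approx[OF dpe cont_pz ce])
    fix s :: real assume s: "0 \<le> s" "s \<le> 1"
    have "fmode 2 e c s = fmode 2 (\<lambda>z. (e z - e c) + e c) c s" by simp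
    also have "\<dots> = fmode 2 (\<lambda>z. e z - e c) c s + fmode 2 (\<lambda>z. e c) c s"
      by (intro fmode_add continuous_intros ce)
    also have "\<dots> = fmode 2 (\<lambda>z. e z - e c) c s" by (simp add: fmode_const)
    finally have "fmode 2 e c s = fmode 2 (\<lambda>z. e z - e c) c s" .
    moreover have "norm (fmode 2 (\<lambda>z. e z - e c) c s) \<le> B * P * s"
    proof (rule fmode_bound)
      show "continuous_on UNIV (\<lambda>z. e z - e c)" by (intro continuous_intros ce)
      show "norm (e (c + of_real s * cis t) - e c) \<le> B * P * s" for t
        using lip[of "c + of_real s * cis t"] s by (simp add: dist_norm norm_mult)
    qed
    ultimately show "norm (fmode 2 e c s) \<le> B * P * s" by simp
  qed simp
  moreover have "norm (fmode 1 p c 1) \<le> P"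
    by (intro fmode_bound cont_p P) (simp add: dist_norm)
  ultimately show ?thesis
    using norm_triangle_sub[of "q c + (p c)\<^sup>2" "fmode 1 p c 1"]
    by (simp add: norm_minus_commute algebra_simps)
qed

lemma linear_growth:
  "\<exists>C\<ge>0. \<forall>z. norm (p z) \<le> C * (1 + norm z) \<and> norm (q z + (p z)\<^sup>2) \<le> C * (1 + norm z)"
proof -
  obtain C where C: "\<And>z. norm (p z) \<le> C * (1 + norm z)" using p_growth by blast
  have C0: "C \<ge> 0" by (rule order_trans[OF norm_ge_zero]) (use C[of 0] in simp)
  define L where "L = 2 * (1 + 2 * B) * C"
  have L: "0 \<le> L" "C \<le> L"
    using C0 B_pos mult_right_mono[of 1 "2 * (1 + 2 * B)" C] by (simp_all add: L_def)
  have "norm (p z) \<le> L * (1 + norm z)" for z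
    using C[of z] mult_right_mono[OF L(2), of "1 + norm z"] by simp
  moreover have "norm (q z + (p z)\<^sup>2) \<le> L * (1 + norm z)" for z
  proof -
    have "norm (q z + (p z)\<^sup>2) \<le> (1 + 2 * B) * (C * (2 + norm z))"
    proof (rule p_z_bound)
      fix w assume "w \<in> cball z 1"
      then have "norm w \<le> norm z + 1"
        using norm_triangle_sub[of w z] by (simp add: dist_norm norm_minus_commute)
      then have "C * (1 + norm w) \<le> C * (2 + norm z)" using C0 by (intro mult_left_mono) auto
      then show "norm (p w) \<le> C * (2 + norm z)" using C[of w] by linarith
    qed
    also have "\<dots> \<le> (1 + 2 * B) * (C * (2 * (1 + norm z)))"
      using C0 B_pos by (intro mult_left_mono) auto
    also have "\<dots> = L * (1 + norm z)" by (simp add: L_def algebra_simps)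
    finally show ?thesis .
  qed
  ultimately show ?thesis using L(1) by blast
qed

end

context bounded_liouville_field
begin

section \<open>Rigidity: the Schwarzian is constant\<close>

lemma q_quadratic: "\<exists>q0 q1 q2. \<forall>z. q z = q0 + q1 * z + q2 * z\<^sup>2"
proof -
  obtain C where C0: "C \<ge> 0" and Cp: "\<And>z. norm (p z) \<le> C * (1 + norm z)"
    and Cpz: "\<And>z. norm (q z + (p z)\<^sup>2) \<le> C * (1 + norm z)"
    using linear_growth by blast
  have "norm (q z) \<le> (2 * C + 4 * C\<^sup>2) * norm z ^ 2" if z: "1 \<le> norm z" for z
  proof -
    have "C * (1 + norm z) \<le> C * (2 * norm z ^ 2)"
      using z C0 self_le_power[of "norm z" 2] by (intro mult_left_mono) auto
    then have 1: "norm (q z + (p z)\<^sup>2) \<le> 2 * C * norm z ^ 2" using Cpz[of z] by simp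
    have "norm (p z) \<le> C * (2 * norm z)"
      using Cp[of z] z C0 mult_left_mono[of "1 + norm z" "2 * norm z" C] by linarith
    then have "norm (p z) ^ 2 \<le> (C * (2 * norm z)) ^ 2" by (intro power_mono) auto
    then have 2: "norm ((p z)\<^sup>2) \<le> 4 * C\<^sup>2 * norm z ^ 2" by (simp add: norm_power power_mult_distrib)
    show ?thesis using norm_triangle_ineq4[of "q z + (p z)\<^sup>2" "(p z)\<^sup>2"] 1 2
      by (simp add: distrib_right)
  qed
  then obtain K where K: "\<And>z. 1 \<le> norm z \<Longrightarrow> norm (q z) \<le> K * norm z ^ 2" by blast
  define c where "c = (\<lambda>k. (deriv ^^ k) q 0 / fact k)"
  have "q z = c 0 + c 1 * z + c 2 * z\<^sup>2" for z
  proof -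
    have "q z = (\<Sum>k\<le>2. c k * z ^ k)"
      unfolding c_def by (rule Liouville_polynomial[OF holomorphic_q K])
    also have "\<dots> = c 0 + c 1 * z + c 2 * z\<^sup>2" by (simp add: numeral_2_eq_2)
    finally show ?thesis .
  qed
  then show ?thesis by blast
qed

text \<open>The point is that \<open>p_z\<close> is bounded by p alone. A first application of the linear growth of \<open>p_z\<close> shows
  \<open>p^2 = O(|z|^d)\<close>, which needs d \<ge> 1. Feeding this back into \<open>p_z_bound\<close> improves the estimate to
  \<open>p_z = O(|z|^(d/2))\<close>, so in \<open>p^2 = p_z - q\<close> the polynomial q dominates.\<close>

lemma p_squared_asymptotics:
  assumes a: "a \<noteq> 0" and d: "d \<ge> 1" and K: "\<And>z. norm z \<ge> 1 \<Longrightarrow> norm (q z - a * z ^ d) \<le> K * norm z ^ (d - 1)"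
  shows "\<exists>R\<ge>1. \<forall>z. norm z \<ge> R \<longrightarrow> norm ((p z)\<^sup>2 / (a * z ^ d) + 1) \<le> 1 / 2"
proof -
  obtain C where C0: "C \<ge> 0" and Cpz: "\<And>z. norm (q z + (p z)\<^sup>2) \<le> C * (1 + norm z)"
    using linear_growth by blast
  have K0: "K \<ge> 0" by (rule order_trans[OF norm_ge_zero]) (use K[of 1] in simp)
  have pw: "1 \<le> norm z ^ d" "norm z \<le> norm z ^ d" if "norm z \<ge> 1" for z :: complex
    using that d self_le_power[of "norm z" d] by (auto simp: one_le_power)
  define L where "L = 2 * C + (norm a + K)"
  have L0: "L \<ge> 0" using C0 K0 by (auto simp: L_def)
  have p2: "norm (p z) ^ 2 \<le> L * norm z ^ d" if z: "norm z \<ge> 1" for z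
  proof -
    have "C * (1 + norm z) \<le> C * (2 * norm z ^ d)"
      using pw[OF z] C0 by (intro mult_left_mono) auto
    then have 1: "norm (q z + (p z)\<^sup>2) \<le> 2 * C * norm z ^ d" using Cpz[of z] by simp
    have "norm (q z) \<le> norm (a * z ^ d) + norm (q z - a * z ^ d)" by (rule norm_triangle_sub)
    also have "\<dots> \<le> norm a * norm z ^ d + K * norm z ^ d"
      using K[OF z] z K0 power_increasing[of "d - 1" d "norm z"]
      by (intro add_mono) (auto simp: norm_mult norm_power intro: order_trans mult_left_mono)
    finally have 2: "norm (q z) \<le> (norm a + K) * norm z ^ d" by (simp add: distrib_right)
    have "norm ((p z)\<^sup>2) \<le> norm (q z + (p z)\<^sup>2) + norm (q z)"
      using norm_triangle_ineq4[of "q z + (p z)\<^sup>2" "q z"] by simp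
    then show ?thesis using 1 2 unfolding L_def norm_power distrib_right by linarith
  qed
  define D where "D = (1 + 2 * B) * sqrt (L * 2 ^ d)"
  have D0: "D \<ge> 0" using B_pos L0 by (auto simp: D_def)
  \<comment> \<open>R makes the final error \<open>(D + K) / (norm a * sqrt (norm z))\<close> at most 1/2, and \<open>R \<ge> 2\<close> keeps the
    unit disc around z in the region where \<open>p2\<close> holds.\<close>
  define R where "R = 2 + (2 * (D + K) / norm a)\<^sup>2"
  have main: "norm ((p z)\<^sup>2 / (a * z ^ d) + 1) \<le> 1 / 2" if z: "norm z \<ge> R" for z
  proof -
    define x where "x = norm z"
    have "R \<ge> 2" by (simp add: R_def)
    then have x: "x \<ge> 2" using z unfolding x_def by linarith
    then have z0: "z \<noteq> 0" by (auto simp: x_def)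
    have xd: "x \<le> x ^ d" using pw(2)[of z] x by (simp add: x_def)
    have "norm (q z + (p z)\<^sup>2) \<le> (1 + 2 * B) * sqrt (L * (2 * x) ^ d)"
    proof (rule p_z_bound)
      fix w assume w: "w \<in> cball z 1"
      have "norm w \<le> x + 1" using w norm_triangle_sub[of w z] by (simp add: dist_norm norm_minus_commute x_def)
      moreover have w1: "norm w \<ge> 1" using w x norm_triangle_sub[of z w] by (simp add: dist_norm x_def)
      ultimately have "norm w ^ d \<le> (2 * x) ^ d" using x by (intro power_mono) auto
      then have "norm (p w) ^ 2 \<le> L * (2 * x) ^ d"
        using p2[OF w1] L0 mult_left_mono[of "norm w ^ d" "(2 * x) ^ d" L] by linarith
      then show "norm (p w) \<le> sqrt (L * (2 * x) ^ d)" by (rule real_le_rsqrt)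
    qed
    also have "\<dots> = D * sqrt (x ^ d)"
      by (simp add: D_def real_sqrt_mult power_mult_distrib)
    also have "sqrt (x ^ d) \<le> x ^ d / sqrt x"
    proof -
      have "sqrt (x ^ d) * sqrt x \<le> sqrt (x ^ d) * sqrt (x ^ d)"
        using xd x by (intro mult_left_mono) auto
      then show ?thesis using x by (simp add: pos_le_divide_eq)
    qed
    then have "D * sqrt (x ^ d) \<le> D * (x ^ d / sqrt x)" using D0 by (rule mult_left_mono)
    finally have 1: "norm (q z + (p z)\<^sup>2) \<le> D * (x ^ d / sqrt x)" .
    have "norm (q z - a * z ^ d) \<le> K * x ^ (d - 1)" using K x by (simp add: x_def)
    also have "x ^ (d - 1) \<le> x ^ d / sqrt x"
    proof -
      have "sqrt x \<le> x" using x by (intro real_le_lsqrt) (auto simp: power2_eq_square)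
      then have "x ^ (d - 1) * sqrt x \<le> x ^ (d - 1) * x" using x by (intro mult_left_mono) auto
      also have "\<dots> = x ^ d" using d by (metis One_nat_def Suc_diff_le diff_Suc_1 power_Suc2)
      finally show ?thesis using x by (simp add: pos_le_divide_eq)
    qed
    then have "K * x ^ (d - 1) \<le> K * (x ^ d / sqrt x)" using K0 by (rule mult_left_mono)
    finally have 2: "norm (q z - a * z ^ d) \<le> K * (x ^ d / sqrt x)" .
    have "(p z)\<^sup>2 / (a * z ^ d) + 1 = ((q z + (p z)\<^sup>2) - (q z - a * z ^ d)) / (a * z ^ d)"
      using a z0 by (simp add: field_simps)
    then have "norm ((p z)\<^sup>2 / (a * z ^ d) + 1) = norm ((q z + (p z)\<^sup>2) - (q z - a * z ^ d)) / (norm a * x ^ d)"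
      by (simp add: norm_divide norm_mult norm_power x_def)
    also have "\<dots> \<le> ((D + K) * (x ^ d / sqrt x)) / (norm a * x ^ d)"
    proof (rule divide_right_mono)
      show "norm ((q z + (p z)\<^sup>2) - (q z - a * z ^ d)) \<le> (D + K) * (x ^ d / sqrt x)"
        using norm_triangle_ineq4[of "q z + (p z)\<^sup>2" "q z - a * z ^ d"] 1 2
        unfolding distrib_right by linarith
    qed (use x in simp)
    also have "\<dots> = (D + K) / norm a / sqrt x" using x by simp
    also have "\<dots> \<le> 1 / 2"
    proof -
      have "(2 * (D + K) / norm a)\<^sup>2 \<le> x" using z unfolding R_def x_def by linarith
      then have "2 * (D + K) / norm a \<le> sqrt x" by (rule real_le_rsqrt)
      then have "2 * ((D + K) / norm a) \<le> sqrt x" by (simp only: times_divide_eq_right)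
      then have "(D + K) / norm a \<le> 1 / 2 * sqrt x" by linarith
      then show ?thesis using x by (subst pos_divide_le_eq) auto
    qed
    finally show ?thesis .
  qed
  have "R \<ge> 1" by (simp add: R_def)
  then show ?thesis using main by blast
qed

text \<open>In the coordinate \<open>w = ln z\<close> the function \<open>k w = p (exp w) exp (- d w / 2) / c0\<close>, with \<open>c0^2 = -a\<close>, has a
  square close to 1 on a half plane. By connectedness its real part keeps one sign \<open>\<sigma>\<close> there. The imaginary part
  \<open>\<theta>\<close> of w is free because w ranges over a whole half plane, not over a strip of height 2 pi, so it can be chosen
  to make \<open>\<sigma> c0 exp ((d / 2 + 1) w)\<close> positive; on that horizontal line u increases at least linearly.\<close>

lemma no_p_squared_asymptotics:
  assumes a: "a \<noteq> 0" and R: "R \<ge> 1"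
    and asym: "\<And>z. norm z \<ge> R \<Longrightarrow> norm ((p z)\<^sup>2 / (a * z ^ d) + 1) \<le> 1 / 2"
  shows False
proof -
  define c0 where "c0 = csqrt (- a)"
  have c0: "c0\<^sup>2 = - a" "c0 \<noteq> 0" using a by (auto simp: c0_def)
  define m where "m = real d / 2"
  define k where "k = (\<lambda>w. p (exp w) * exp (- of_real m * w) / c0)"
  define H where "H = {w. Re w \<ge> ln R}"
  have k2: "(k w)\<^sup>2 = - ((p (exp w))\<^sup>2 / (a * exp w ^ d))" for w
  proof -
    have "exp (- of_real m * w) ^ 2 = exp (2 * (- of_real m * w))" by (rule exp_double[symmetric])
    also have "2 * (- of_real m * w) = - (of_nat d * w)" by (simp add: m_def)
    also have "exp (- (of_nat d * w)) = inverse (exp w ^ d)" by (simp only: exp_minus exp_of_nat_mult)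
    finally have "exp (- of_real m * w) ^ 2 = inverse (exp w ^ d)" .
    then show ?thesis unfolding k_def power_divide power_mult_distrib c0(1)
      by (simp add: divide_inverse)
  qed
  have Rek: "\<bar>Re (k w)\<bar> \<ge> 1 / 2" if w: "w \<in> H" for w
  proof -
    have "exp (ln R) \<le> exp (Re w)" using w by (simp add: H_def)
    then have "norm (exp w) \<ge> R" using R by (simp add: norm_exp_eq_Re)
    from asym[OF this] have "norm (1 - (k w)\<^sup>2) \<le> 1 / 2" by (simp add: k2 add.commute)
    then have "Re (1 - (k w)\<^sup>2) \<le> 1 / 2" using complex_Re_le_cmod order_trans by blast
    then have "(Re (k w))\<^sup>2 \<ge> 1 / 2 + (Im (k w))\<^sup>2" by (simp add: Re_power2)
    moreover have "(Im (k w))\<^sup>2 \<ge> 0" by simp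
    moreover have "(1 / 2 :: real)\<^sup>2 = 1 / 4" by (simp add: power2_eq_square)
    ultimately have "(1 / 2)\<^sup>2 \<le> \<bar>Re (k w)\<bar>\<^sup>2" unfolding power2_abs by linarith
    then show ?thesis by (rule power2_le_imp_le) simp
  qed
  have conn: "connected ((\<lambda>w. Re (k w)) ` H)"
  proof (rule connected_continuous_image)
    have "continuous_on H (\<lambda>w. p (exp w))"
      by (rule continuous_on_compose2[OF cont_p[of UNIV] continuous_on_exp[OF continuous_on_id]]) simp
    then show "continuous_on H (\<lambda>w. Re (k w))" unfolding k_def
      using c0(2) by (intro continuous_intros) auto
    show "connected H" unfolding H_def by (rule convex_connected[OF convex_halfspace_Re_ge])
  qed
  have no0: "0 \<notin> (\<lambda>w. Re (k w)) ` H" using Rek by force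
  obtain \<sigma> :: real where \<sigma>: "\<sigma> * \<sigma> = 1" "\<And>w. w \<in> H \<Longrightarrow> \<sigma> * Re (k w) \<ge> 1 / 2"
  proof (cases "\<exists>w\<in>H. Re (k w) > 0")
    case True
    then obtain w0 where w0: "w0 \<in> H" "Re (k w0) > 0" by blast
    have "Re (k w) \<ge> 1 / 2" if w: "w \<in> H" for w
    proof -
      have "\<not> Re (k w) \<le> 0"
      proof
        assume "Re (k w) \<le> 0"
        then have "0 \<in> (\<lambda>w. Re (k w)) ` H"
          using connectedD_interval[OF conn imageI[OF w] imageI[OF w0(1)], of 0] w0(2) by simp
        then show False using no0 by simp
      qed
      then show ?thesis using Rek[OF w] by simp
    qed
    then show thesis using that[of 1] by simp
  next
    case False
    have "- Re (k w) \<ge> 1 / 2" if w: "w \<in> H" for w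
    proof -
      have "Re (k w) \<le> 0" using False w by (meson not_le)
      then show ?thesis using Rek[OF w] by simp
    qed
    then show thesis using that[of "-1"] by simp
  qed
  define \<theta> where "\<theta> = - Arg (of_real \<sigma> * c0) / (m + 1)"
  have m: "m \<ge> 0" by (simp add: m_def)
  have \<sigma>0: "\<sigma> \<noteq> 0" "\<bar>\<sigma>\<bar> = 1" using \<sigma>(1) by (auto simp: abs_if square_eq_1_iff)
  have dir: "c0 * exp (of_real (m + 1) * (of_real x + \<i> * of_real \<theta>)) = of_real (\<sigma> * norm c0 * exp ((m + 1) * x))" for x
  proof -
    have "of_real \<sigma> * c0 \<noteq> 0" using \<sigma>0 c0 by simp
    then have A: "of_real \<sigma> * c0 = of_real (norm c0) * exp (\<i> * of_real (Arg (of_real \<sigma> * c0)))"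
      using Arg_eq[of "of_real \<sigma> * c0"] \<sigma>0 by (simp add: norm_mult)
    have "of_real (m + 1) * (of_real x + \<i> * of_real \<theta>) = of_real ((m + 1) * x) + (- (\<i> * of_real (Arg (of_real \<sigma> * c0))))"
      using m by (simp add: \<theta>_def complex_eq_iff field_simps)
    then have "exp (of_real (m + 1) * (of_real x + \<i> * of_real \<theta>)) =
        of_real (exp ((m + 1) * x)) * exp (- (\<i> * of_real (Arg (of_real \<sigma> * c0))))"
      by (simp only: exp_add exp_of_real)
    then have "(of_real \<sigma> * c0) * exp (of_real (m + 1) * (of_real x + \<i> * of_real \<theta>)) = of_real (norm c0 * exp ((m + 1) * x))"
      by (subst A) (simp add: exp_minus)
    then have "of_real \<sigma> * (of_real \<sigma> * c0 * exp (of_real (m + 1) * (of_real x + \<i> * of_real \<theta>))) = of_real (\<sigma> * norm c0 * exp ((m + 1) * x))"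
      by (simp add: mult.assoc)
    moreover have "of_real \<sigma> * (of_real \<sigma> * c0 * E) = c0 * E" for E :: complex
      using \<sigma>(1) by (simp flip: mult.assoc of_real_mult)
    ultimately show ?thesis by simp
  qed
  define g where "g = (\<lambda>x::real. exp (of_real x + \<i> * of_real \<theta>))"
  define x0 where "x0 = ln R"
  have x0: "x0 \<ge> 0" using R by (simp add: x0_def)
  have grow: "norm c0 \<le> 2 * Re (p (g x) * g x)" if x: "x \<ge> x0" for x
  proof -
    define w where "w = of_real x + \<i> * of_real \<theta>"
    have wH: "w \<in> H" using x by (simp add: H_def w_def x0_def)
    have "p (exp w) = k w * c0 * exp (of_real m * w)"
      using c0(2) by (simp add: k_def exp_minus)
    moreover have "g x = exp w" by (simp only: g_def w_def)
    moreover have "exp (of_real (m + 1) * w) = exp (of_real m * w) * exp w"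
      by (simp add: distrib_right flip: exp_add)
    ultimately have "p (g x) * g x = k w * (c0 * exp (of_real (m + 1) * w))"
      by (simp only: mult.assoc)
    also have "\<dots> = k w * of_real (\<sigma> * norm c0 * exp ((m + 1) * x))"
      using dir[of x] by (simp only: w_def)
    finally have "Re (p (g x) * g x) = Re (k w) * (\<sigma> * norm c0 * exp ((m + 1) * x))"
      by (simp only: Re_complex_of_real Im_complex_of_real mult_zero_right diff_zero times_complex.sel)
    also have "\<dots> = (\<sigma> * Re (k w)) * (norm c0 * exp ((m + 1) * x))" by (simp only: ac_simps)
    also have "\<dots> \<ge> 1 / 2 * (norm c0 * 1)"
    proof (rule mult_mono)
      show "norm c0 * 1 \<le> norm c0 * exp ((m + 1) * x)"
        using x x0 m by (intro mult_left_mono) auto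
      show "1 / 2 \<le> \<sigma> * Re (k w)" using \<sigma>(2)[OF wH] .
      then show "0 \<le> \<sigma> * Re (k w)" by simp
    qed simp
    finally show ?thesis by simp
  qed
  have up: "u (g x0) - norm c0 * x0 \<le> u (g x) - norm c0 * x" if "x \<ge> x0" for x
  proof (rule DERIV_nonneg_imp_nondecreasing[OF that])
    fix s assume s: "x0 \<le> s" "s \<le> x"
    have "((\<lambda>w. exp (w + \<i> * of_real \<theta>)) has_field_derivative g s) (at (of_real s))"
      unfolding g_def by (auto intro!: derivative_eq_intros)
    from has_vector_derivative_real_field[OF has_field_derivative_at_within[OF this]]
    have "(g has_vector_derivative g s) (at s)" by (simp add: g_def)
    from u_path[OF this]
    have "((\<lambda>s. u (g s) - norm c0 * s) has_real_derivative 2 * Re (p (g s) * g s) - norm c0) (at s)"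
      by (auto intro!: derivative_eq_intros)
    then show "\<exists>y. ((\<lambda>s. u (g s) - norm c0 * s) has_real_derivative y) (at s) \<and> 0 \<le> y"
      using grow[OF s(1)] by auto
  qed
  \<comment> \<open>After this time the lower bound for u exceeds M.\<close>
  define t where "t = (M + 1 - u (g x0)) / norm c0"
  have "t > 0" using u_le[of "g x0"] c0 by (simp add: t_def)
  then have "u (g x0) + norm c0 * t \<le> u (g (x0 + t))" using up[of "x0 + t"] by (simp add: distrib_left)
  then show False using u_le[of "g (x0 + t)"] c0 by (simp add: t_def)
qed

lemma q_constant: "\<exists>k. \<forall>z. q z = k"
proof -
  obtain q0 q1 q2 where q: "\<And>z. q z = q0 + q1 * z + q2 * z\<^sup>2" using q_quadratic by blast
  have "q2 = 0"
  proof (rule ccontr)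
    assume a: "q2 \<noteq> 0"
    have "norm (q z - q2 * z ^ 2) \<le> (norm q0 + norm q1) * norm z ^ (2 - 1)" if "norm z \<ge> 1" for z
    proof -
      have "norm (q z - q2 * z ^ 2) \<le> norm q0 + norm q1 * norm z"
        using norm_triangle_ineq[of q0 "q1 * z"] by (simp add: q norm_mult)
      also have "norm q0 \<le> norm q0 * norm z" using that by (simp add: mult_le_cancel_left1)
      finally show ?thesis by (simp add: distrib_right)
    qed
    from p_squared_asymptotics[OF a _ this] no_p_squared_asymptotics[OF a] show False by fastforce
  qed
  moreover have "q1 = 0"
  proof (rule ccontr)
    assume a: "q1 \<noteq> 0"
    have "norm (q z - q1 * z ^ 1) \<le> norm q0 * norm z ^ (1 - 1)" if "norm z \<ge> 1" for z
      using q \<open>q2 = 0\<close> by simp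
    from p_squared_asymptotics[OF a _ this] no_p_squared_asymptotics[OF a] show False by fastforce
  qed
  ultimately show ?thesis using q by auto
qed

end

section \<open>Solutions with constant Schwarzian\<close>

lemma liouville_solution_field:
  assumes "liouville_solution u"
  shows "\<exists>p q. liouville_field u p q"
proof -
  define ux uy where "ux = partial_deriv 1 u" and "uy = partial_deriv \<i> u"
  have C2u: "C2 u" and eq: "- laplacian u z = exp (2 * u z)" for z
    using assms by (auto simp: liouville_solution_def)
  have C: "C1 u" "C1 ux" "C1 uy"
    using C2u by (auto simp: C2_def ux_def uy_def Basis_complex_def)
  define p where "p = (\<lambda>z. Complex (ux z) (- uy z) / 2)"
  define pz where "pz = (\<lambda>z. 1 / 2 * (Complex (partial_deriv 1 ux z) (- partial_deriv \<i> ux z) / 2)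
      + (- \<i> / 2) * (Complex (partial_deriv 1 uy z) (- partial_deriv \<i> uy z) / 2))"
  have p_eq: "p = (\<lambda>z. 1 / 2 * of_real (ux z) + (- \<i> / 2) * of_real (uy z))"
    by (simp add: p_def fun_eq_iff complex_eq_iff)
  have "liouville_field u p (\<lambda>z. pz z - (p z)\<^sup>2)"
  proof
    fix z
    show "wirtinger (\<lambda>z. of_real (u z)) (p z) (cnj (p z)) z"
      using C1_wirtinger[OF C(1), of z] by (simp add: p_def ux_def uy_def complex_cnj)
    have "partial_deriv 1 ux z + partial_deriv \<i> uy z = - exp (2 * u z)"
      using eq[of z] by (simp add: laplacian_complex ux_def uy_def)
    moreover have "partial_deriv 1 uy z = partial_deriv \<i> ux z"
      using C2_mixed_partials[OF C2u] by (simp add: ux_def uy_def)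
    moreover have "exp (2 * complex_of_real (u z)) = of_real (exp (2 * u z))"
      by (simp flip: exp_of_real)
    ultimately have "1 / 2 * (Complex (partial_deriv 1 ux z) (partial_deriv \<i> ux z) / 2)
      + (- \<i> / 2) * (Complex (partial_deriv 1 uy z) (partial_deriv \<i> uy z) / 2) = - exp (2 * of_real (u z)) / 4"
      by (simp add: complex_eq_iff)
    with wirtinger_add[OF wirtinger_cmult[OF C1_wirtinger[OF C(2), of z], where c = "1 / 2"]
        wirtinger_cmult[OF C1_wirtinger[OF C(3), of z], where c = "- \<i> / 2"]]
    show "wirtinger p (pz z - (p z)\<^sup>2 + (p z)\<^sup>2) (- exp (2 * of_real (u z)) / 4) z"
      unfolding p_eq pz_def by simp
  next
    have "continuous_on UNIV p" unfolding p_eq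
      using C(1) by (intro continuous_intros) (auto simp: C1_def ux_def uy_def Basis_complex_def)
    moreover have "continuous_on UNIV pz" unfolding pz_def
      using C by (intro continuous_intros) (auto simp: C1_def Basis_complex_def)
    ultimately show "continuous_on UNIV (\<lambda>z. pz z - (p z)\<^sup>2)" by (intro continuous_intros)
  qed
  then show ?thesis by blast
qed

locale constant_schwarzian = liouville_field u p "\<lambda>z. k" for u p k
begin

text \<open>With \<open>g = exp (- u)\<close>, the quadruple of g, its two first derivatives and its mixed second derivative \<open>N\<close>
  solves a linear system with constant coefficients. The function \<open>N\<close> is given by the formula it has in
  terms of u and p, because in this form it is visibly differentiable and positive.\<close>

abbreviation g :: "complex \<Rightarrow> complex" where "g z \<equiv> exp (- of_real (u z))"
abbreviation g\<^sub>z :: "complex \<Rightarrow> complex" where "g\<^sub>z z \<equiv> - p z * g z"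
definition n :: "complex \<Rightarrow> real" where "n z = exp (- u z) * (norm (p z))\<^sup>2 + exp (u z) / 4"
abbreviation N :: "complex \<Rightarrow> complex" where "N z \<equiv> of_real (n z)"

lemma N_eq: "N z = g z * (p z * cnj (p z)) + 1 / 4 * exp (of_real (u z))"
  unfolding n_def complex_norm_square[symmetric] by (simp add: exp_of_real[symmetric] flip: of_real_minus)

lemma g_exp: "g z * exp (of_real (u z)) = 1" "g z * exp (2 * of_real (u z)) = exp (of_real (u z))"
  by (simp_all flip: exp_add)

lemma n_pos: "n z > 0"
  unfolding n_def by (intro add_nonneg_pos) auto

lemma cnj_g: "cnj (g z) = g z" by (simp add: exp_cnj)

text \<open>The determinant of the Hermitian matrix formed by g, its first derivatives and \<open>N\<close> is constant. This is
  the Liouville equation once more, and it fixes the integration constants below.\<close>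

lemma g_N: "g z * N z = g\<^sub>z z * cnj (g\<^sub>z z) + 1 / 4"
  using g_exp(1)[of z] unfolding N_eq by (simp add: cnj_g distrib_left mult_ac)

lemma dg: "wirtinger g (g\<^sub>z z) (cnj (g\<^sub>z z)) z"
  using dexp[of "-1" z] by (simp add: cnj_g exp_cnj mult.commute)

lemma dg\<^sub>z: "wirtinger g\<^sub>z (- k * g z) (N z) z"
proof -
  have "wirtinger (\<lambda>z. - p z * g z) (- (k + (p z)\<^sup>2) * g z + - p z * g\<^sub>z z)
     (- (- exp (2 * of_real (u z)) / 4) * g z + - p z * cnj (g\<^sub>z z)) z"
    by (rule wirtinger_mult[OF wirtinger_minus[OF dp] dg])
  moreover have "- (k + (p z)\<^sup>2) * g z + - p z * g\<^sub>z z = - k * g z"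
    by (simp add: algebra_simps power2_eq_square)
  moreover have "- (- exp (2 * of_real (u z)) / 4) * g z + - p z * cnj (g\<^sub>z z) = N z"
    using g_exp(2)[of z] unfolding N_eq by (simp add: cnj_g mult_ac)
  ultimately show ?thesis by metis
qed

lemma dN: "wirtinger N (- k * cnj (g\<^sub>z z)) (- cnj k * g\<^sub>z z) z"
proof -
  let ?E = "exp (2 * of_real (u z)) :: complex"
  have cE: "cnj ?E = ?E" by (simp add: exp_cnj)
  have ce: "exp (1 * of_real (u z)) = (g z * ?E)" using g_exp(2)[of z] by simp
  have "wirtinger (\<lambda>z. g z * (p z * cnj (p z)) + 1 / 4 * exp (1 * of_real (u z)))
    (g\<^sub>z z * (p z * cnj (p z)) + g z * ((k + (p z)\<^sup>2) * cnj (p z) + p z * cnj (- ?E / 4)) + 1 / 4 * (exp (1 * of_real (u z)) * (1 * p z)))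
    (cnj (g\<^sub>z z) * (p z * cnj (p z)) + g z * ((- ?E / 4) * cnj (p z) + p z * cnj (k + (p z)\<^sup>2)) + 1 / 4 * (exp (1 * of_real (u z)) * (1 * cnj (p z)))) z"
    by (rule wirtinger_add[OF wirtinger_mult[OF dg wirtinger_mult[OF dp wirtinger_cnj[OF dp]]] wirtinger_cmult[OF dexp]])
  moreover have "g\<^sub>z z * (p z * cnj (p z)) + g z * ((k + (p z)\<^sup>2) * cnj (p z) + p z * cnj (- ?E / 4)) + 1 / 4 * (exp (1 * of_real (u z)) * (1 * p z))
     = - k * cnj (g\<^sub>z z)"
    unfolding ce by (simp add: cE cnj_g algebra_simps power2_eq_square)
  moreover have "cnj (g\<^sub>z z) * (p z * cnj (p z)) + g z * ((- ?E / 4) * cnj (p z) + p z * cnj (k + (p z)\<^sup>2)) + 1 / 4 * (exp (1 * of_real (u z)) * (1 * cnj (p z)))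
     = - cnj k * g\<^sub>z z"
    unfolding ce by (simp add: cnj_g algebra_simps power2_eq_square)
  ultimately show ?thesis unfolding N_eq by simp
qed

lemma u_from_g:
  assumes "exp (- u z) = d / (2 * L)" "L > 0"
  shows "u z = ln L + ln (2 / d)"
proof -
  have d: "d > 0" using assms by (metis exp_gt_zero zero_less_divide_iff mult_pos_pos zero_less_numeral not_less_iff_gr_or_eq)
  have "- u z = ln (d / (2 * L))" using assms(1) by (metis ln_exp)
  also have "\<dots> = - (ln L + ln (2 / d))" using d assms(2) by (simp add: ln_div ln_mult)
  finally show ?thesis by simp
qed

text \<open>If k = 0, then \<open>N\<close> is a positive constant c and \<open>g_z\<close> minus c times the conjugate variable is constant, so
  \<open>g_N\<close> exhibits g as a sum of squares divided by c.\<close>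

lemma zero_case:
  assumes "k = 0"
  shows "\<exists>l z0. l \<noteq> 0 \<and> (\<forall>z. u z = ln (cmod l) + ln (2 / (1 + (Re (l * z + z0))\<^sup>2 + (Im (l * z + z0))\<^sup>2)))"
proof -
  have Nc: "n z = n 0" for z
  proof -
    have "N z = N 0" using dN by (intro wirtinger_zero_const[of N]) (simp add: assms)
    then show ?thesis by simp
  qed
  define c a where "c = n 0" and "a = g\<^sub>z 0"
  have c: "c > 0" using n_pos by (simp add: c_def)
  have lin: "g\<^sub>z z = a + of_real c * cnj z" for z
  proof -
    have id: "wirtinger (\<lambda>z. z) 1 0 z" for z by (simp add: wirtinger_def)
    have "wirtinger (\<lambda>z. g\<^sub>z z + - (of_real c * cnj z)) 0 0 z" for z
      using wirtinger_add[OF dg\<^sub>z wirtinger_minus[OF wirtinger_cmult[OF wirtinger_cnj[OF id], where c = "of_real c"]], of z] Nc[of z]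
      by (simp add: assms c_def)
    from wirtinger_zero_const[OF this, of z] show ?thesis
      by (simp add: a_def algebra_simps)
  qed
  have "u z = ln (cmod (2 * of_real c)) + ln (2 / (1 + (Re ((2 * of_real c) * z + 2 * cnj a))\<^sup>2 + (Im ((2 * of_real c) * z + 2 * cnj a))\<^sup>2))" for z
  proof (rule u_from_g)
    have "of_real (exp (- u z) * c) = g z * N z" using Nc[of z] by (simp add: c_def exp_of_real flip: of_real_minus)
    also have "\<dots> = of_real ((cmod (g\<^sub>z z))\<^sup>2 + 1 / 4)" unfolding g_N of_real_add complex_norm_square by simp
    finally have "exp (- u z) * c = (cmod (g\<^sub>z z))\<^sup>2 + 1 / 4" by (simp only: of_real_eq_iff)
    also have "\<dots> = (1 + (Re ((2 * of_real c) * z + 2 * cnj a))\<^sup>2 + (Im ((2 * of_real c) * z + 2 * cnj a))\<^sup>2) / 4"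
      unfolding lin cmod_power2 by (simp add: power2_eq_square algebra_simps)
    finally show "exp (- u z) = (1 + (Re ((2 * of_real c) * z + 2 * cnj a))\<^sup>2 + (Im ((2 * of_real c) * z + 2 * cnj a))\<^sup>2) / (2 * cmod (2 * of_real c))"
      using c by (simp add: norm_mult eq_divide_eq) 
  qed (use c in simp)
  then show ?thesis using c by (intro exI[of _ "2 * of_real c"] exI[of _ "2 * cnj a"]) auto
qed


text \<open>For \<open>k = - b^2\<close> the combinations \<open>K s t\<close> with signs s and t diagonalise the linear system: each is an
  eigenvector for both derivatives, hence a multiple of one exponential, and g is recovered from the four of them.
  The two diagonal coefficients \<open>\<alpha>\<close>, \<open>\<delta>\<close> are real, the other two are conjugate to each other, and \<open>g_N\<close>
  becomes \<open>\<alpha> \<delta> = |\<beta>|^2 + |b|^2\<close>. So \<open>\<alpha>\<close> and \<open>\<delta>\<close> are positive. The real part of \<open>z0\<close> normalises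
  \<open>\<alpha>\<close>, its imaginary part absorbs the argument of \<open>\<beta>\<close>, and \<open>t = |\<beta>| / |b|\<close> is the remaining parameter.\<close>

lemma nonzero_case:
  assumes k: "k \<noteq> 0"
  shows "\<exists>l z0 t. l \<noteq> 0 \<and> t \<ge> 0 \<and> (\<forall>z. u z = ln (cmod l) + ln (2 * exp (Re (l * z + z0)) /
      (1 + t\<^sup>2 + 2 * t * exp (Re (l * z + z0)) * cos (Im (l * z + z0)) + exp (2 * Re (l * z + z0)))))"
proof -
  define b where "b = csqrt (- k)"
  have bb: "b * b = - k" by (simp add: b_def flip: power2_eq_square)
  have b0: "b \<noteq> 0" using bb k by auto
  have bc: "cnj b * cnj b = - cnj k" using bb by (metis complex_cnj_minus complex_cnj_mult)
  define K where "K = (\<lambda>s t z. N z + s * b * cnj (g\<^sub>z z) + t * cnj b * g\<^sub>z z + s * t * b * cnj b * g z)"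
  have K_exp: "K s t z = K s t 0 * exp (s * b * z + t * cnj (b * z))" if st: "s * s = 1" "t * t = 1" for s t z
  proof -
    let ?e = "\<lambda>z. (- (s * b)) * z + (- (t * cnj b)) * cnj z"
    have id: "wirtinger (\<lambda>z. z) 1 0 z" for z by (simp add: wirtinger_def)
    have dK: "wirtinger (K s t) (s * b * K s t z) (t * cnj b * K s t z) z" for z
    proof -
      have "wirtinger (\<lambda>z. N z + (s * b) * cnj (g\<^sub>z z) + (t * cnj b) * g\<^sub>z z + (s * t * b * cnj b) * g z)
         (- k * cnj (g\<^sub>z z) + (s * b) * cnj (N z) + (t * cnj b) * (- k * g z) + (s * t * b * cnj b) * g\<^sub>z z)
         (- cnj k * g\<^sub>z z + (s * b) * cnj (- k * g z) + (t * cnj b) * N z + (s * t * b * cnj b) * cnj (g\<^sub>z z)) z"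
        by (intro wirtinger_add wirtinger_cmult wirtinger_cnj dN dg dg\<^sub>z)
      moreover have "- k * cnj (g\<^sub>z z) + (s * b) * cnj (N z) + (t * cnj b) * (- k * g z) + (s * t * b * cnj b) * g\<^sub>z z
         = s * b * K s t z"
      proof -
        have "s * b * K s t z = (s * b) * N z + (s * s) * (b * b) * cnj (g\<^sub>z z) + (s * t * b * cnj b) * g\<^sub>z z + (s * s) * (b * b) * t * cnj b * g z"
          unfolding K_def by (simp only: distrib_left ac_simps)
        then show ?thesis unfolding st bb by (simp add: algebra_simps)
      qed
      moreover have "- cnj k * g\<^sub>z z + (s * b) * cnj (- k * g z) + (t * cnj b) * N z + (s * t * b * cnj b) * cnj (g\<^sub>z z)
         = t * cnj b * K s t z"
      proof -
        have "t * cnj b * K s t z = (t * cnj b) * N z + (t * t) * (cnj b * cnj b) * g\<^sub>z z + (s * t * b * cnj b) * cnj (g\<^sub>z z) + (t * t) * (cnj b * cnj b) * s * b * g z"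
          unfolding K_def by (simp only: distrib_left ac_simps)
        then show ?thesis unfolding st bc by (simp add: cnj_g algebra_simps)
      qed
      ultimately show ?thesis unfolding K_def by (simp only: mult.assoc)
    qed
    have de: "wirtinger ?e (- (s * b)) (- (t * cnj b)) z" for z
      using wirtinger_add[OF wirtinger_cmult[OF id, where c = "- (s * b)"] wirtinger_cmult[OF wirtinger_cnj[OF id], where c = "- (t * cnj b)"]]
      by simp
    have "wirtinger (\<lambda>z. K s t z * exp (?e z)) 0 0 z" for z
      using wirtinger_mult[OF dK wirtinger_exp[OF de], of z] by (simp add: algebra_simps)
    from wirtinger_zero_const[OF this, of z]
    have "K s t z * exp (?e z) = K s t 0" by simp
    moreover have "exp (?e z) * exp (s * b * z + t * cnj (b * z)) = 1"
      by (simp add: mult.assoc flip: exp_add)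
    ultimately show ?thesis by (metis mult.assoc mult.right_neutral)
  qed
  define r where "r = cmod b"
  have r0: "r > 0" using b0 by (simp add: r_def)
  have r2: "b * cnj b = of_real (r\<^sup>2)" by (simp only: r_def complex_norm_square)
  define x where "x = Re (b * cnj (g\<^sub>z 0))"
  define y where "y = Im (b * cnj (g\<^sub>z 0))"
  define G where "G = exp (- u 0)"
  have G: "G > 0" "g 0 = of_real G" by (simp_all add: G_def exp_of_real flip: of_real_minus)
  have bg1: "b * cnj (g\<^sub>z 0) = Complex x y" by (simp only: x_def y_def complex.collapse)
  have "cnj b * g\<^sub>z 0 = cnj (b * cnj (g\<^sub>z 0))" by (simp only: complex_cnj_mult complex_cnj_cnj)
  then have bg: "b * cnj (g\<^sub>z 0) = Complex x y" "cnj b * g\<^sub>z 0 = Complex x (- y)"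
    by (simp_all only: bg1 complex_cnj)
  \<comment> \<open>The determinant identity \<open>g_N\<close> at 0, multiplied by \<open>|b|^2\<close> and written in real coordinates.\<close>
  have Gn: "G * n 0 * r\<^sup>2 = x\<^sup>2 + y\<^sup>2 + r\<^sup>2 / 4"
  proof -
    have "of_real (G * n 0 * r\<^sup>2) = (g 0 * N 0) * (b * cnj b)" by (simp add: G r2)
    also have "\<dots> = (b * cnj (g\<^sub>z 0)) * (cnj b * g\<^sub>z 0) + (b * cnj b) / 4"
      unfolding g_N by (simp add: algebra_simps)
    also have "\<dots> = of_real (x\<^sup>2 + y\<^sup>2 + r\<^sup>2 / 4)"
      unfolding bg r2 by (simp add: complex_eq_iff power2_eq_square)
    finally show ?thesis by (simp only: of_real_eq_iff)
  qed
  define \<alpha> \<delta> \<beta> where "\<alpha> = n 0 + 2 * x + r\<^sup>2 * G" and "\<delta> = n 0 - 2 * x + r\<^sup>2 * G"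
    and "\<beta> = Complex (r\<^sup>2 * G - n 0) (- 2 * y)"
  have K0: "K s t 0 = N 0 + s * Complex x y + t * Complex x (- y) + s * t * of_real (r\<^sup>2 * G)" for s t
  proof -
    have "K s t 0 = N 0 + s * (b * cnj (g\<^sub>z 0)) + t * (cnj b * g\<^sub>z 0) + s * t * ((b * cnj b) * g 0)"
      unfolding K_def by (simp only: mult.assoc)
    then show ?thesis unfolding bg unfolding r2 G(2) of_real_mult .
  qed
  have Ks: "K 1 1 0 = of_real \<alpha>" "K (-1) (-1) 0 = of_real \<delta>" "K 1 (-1) 0 = - \<beta>" "K (-1) 1 0 = - cnj \<beta>"
    unfolding K0 \<alpha>_def \<delta>_def \<beta>_def by (simp_all add: complex_eq_iff)
  have ad: "\<alpha> * \<delta> = (cmod \<beta>)\<^sup>2 + r\<^sup>2"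
    using Gn unfolding \<alpha>_def \<delta>_def \<beta>_def cmod_power2 by (simp add: power2_eq_square algebra_simps)
  have "\<alpha> + \<delta> > 0" using n_pos[of 0] G r0 by (simp add: \<alpha>_def \<delta>_def add_pos_pos)
  moreover have "\<alpha> * \<delta> > 0" unfolding ad using r0 by (simp add: add_nonneg_pos)
  ultimately have \<alpha>0: "\<alpha> > 0" by (auto simp: zero_less_mult_iff)
  define t where "t = cmod \<beta> / r"
  define z0 where "z0 = Complex (ln (\<alpha> / r)) (Arg \<beta>)"
  have "u z = ln (cmod (2 * b)) + ln (2 * exp (Re (2 * b * z + z0)) /
      (1 + t\<^sup>2 + 2 * t * exp (Re (2 * b * z + z0)) * cos (Im (2 * b * z + z0)) + exp (2 * Re (2 * b * z + z0))))" for z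
  proof -
    define X Y where "X = Re (2 * b * z + z0)" and "Y = Im (2 * b * z + z0)"
    define w where "w = b * z"
    have "4 * (b * cnj b) * g z = K 1 1 z + K (-1) (-1) z - K 1 (-1) z - K (-1) 1 z"
      unfolding K_def by (simp add: algebra_simps)
    also have "\<dots> = of_real \<alpha> * exp (w + cnj w) + of_real \<delta> * exp (- w - cnj w) + \<beta> * exp (w - cnj w) + cnj \<beta> * exp (- w + cnj w)"
      using K_exp[of 1 1 z] K_exp[of "-1" "-1" z] K_exp[of 1 "-1" z] K_exp[of "-1" 1 z] Ks by (simp add: w_def)
    also have "w + cnj w = of_real (2 * Re w)" by (simp add: complex_eq_iff)
    also have "- w - cnj w = of_real (- 2 * Re w)" by (simp add: complex_eq_iff)
    also have "w - cnj w = \<i> * of_real (2 * Im w)" by (simp add: complex_eq_iff)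
    also have "- w + cnj w = \<i> * of_real (- 2 * Im w)" by (simp add: complex_eq_iff)
    finally have "4 * r\<^sup>2 * exp (- u z) = Re (of_real \<alpha> * exp (of_real (2 * Re w)) + of_real \<delta> * exp (of_real (- 2 * Re w))
        + \<beta> * cis (2 * Im w) + cnj \<beta> * cis (- 2 * Im w))"
      unfolding r2 cis_conv_exp by (metis Re_complex_of_real exp_of_real of_real_minus of_real_mult of_real_numeral)
    also have "\<dots> = \<alpha> * exp (2 * Re w) + \<delta> * exp (- 2 * Re w) + 2 * Re (\<beta> * cis (2 * Im w))"
      unfolding exp_of_real by simp
    also have "\<beta> * cis (2 * Im w) = rcis (cmod \<beta>) Y"
    proof -
      have "\<beta> * cis (2 * Im w) = rcis (cmod \<beta>) (Arg \<beta>) * cis (2 * Im w)" by (simp only: rcis_cmod_Arg)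
      then show ?thesis by (simp add: rcis_def cis_mult Y_def w_def z0_def mult.assoc add.commute)
    qed
    finally have main: "4 * r\<^sup>2 * exp (- u z) = \<alpha> * exp (2 * Re w) + \<delta> * exp (- 2 * Re w) + 2 * cmod \<beta> * cos Y" by simp
    have eX: "exp X = exp (2 * Re w) * (\<alpha> / r)"
      using \<alpha>0 r0 by (simp add: X_def w_def z0_def exp_add mult.assoc)
    have t2: "1 + t\<^sup>2 = \<alpha> * \<delta> / r\<^sup>2" using r0 by (simp add: ad t_def power_divide add_divide_distrib)
    have "\<alpha> * exp (2 * Re w) = r * exp X" unfolding eX using r0 by simp
    moreover have "\<delta> * exp (- 2 * Re w) = r * ((1 + t\<^sup>2) / exp X)"
      unfolding eX t2 using r0 \<alpha>0 by (simp add: exp_minus field_simps power2_eq_square)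
    moreover have "2 * cmod \<beta> * cos Y = r * (2 * t * cos Y)" using r0 by (simp add: t_def)
    ultimately have "4 * r\<^sup>2 * exp (- u z) = r * (exp X + (1 + t\<^sup>2) / exp X + 2 * t * cos Y)"
      using main by (simp add: distrib_left)
    then have "r * (4 * r * exp (- u z)) = r * (exp X + (1 + t\<^sup>2) / exp X + 2 * t * cos Y)"
      by (simp add: power2_eq_square mult_ac)
    then have "4 * r * exp (- u z) = exp X + (1 + t\<^sup>2) / exp X + 2 * t * cos Y" using r0 by simp
    also have "\<dots> = (1 + t\<^sup>2 + 2 * t * exp X * cos Y + exp (2 * X)) / exp X"
      unfolding exp_double by (simp add: field_simps power2_eq_square)
    finally have "exp (- u z) = (1 + t\<^sup>2 + 2 * t * exp X * cos Y + exp (2 * X)) / exp X / (2 * (2 * r))"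
      using r0 by (simp add: field_simps)
    from u_from_g[OF this] show ?thesis using r0 unfolding X_def[symmetric] Y_def[symmetric]
      by (simp add: r_def norm_mult)
  qed
  moreover have "t \<ge> 0" using r0 by (simp add: t_def)
  ultimately show ?thesis using b0 by (intro exI[of _ "2 * b"] exI[of _ z0] exI[of _ t]) simp
qed

end

section \<open>The classification\<close>

lemma spherical_profile_le: "ln (2 / (1 + x\<^sup>2 + y\<^sup>2)) \<le> ln 2" for x y :: real
proof -
  have "x\<^sup>2 \<ge> 0" "y\<^sup>2 \<ge> 0" by simp_all
  then have "1 + x\<^sup>2 + y\<^sup>2 \<ge> 1" "1 + x\<^sup>2 + y\<^sup>2 > 0" by linarith+
  then have "2 / (1 + x\<^sup>2 + y\<^sup>2) \<le> 2" "2 / (1 + x\<^sup>2 + y\<^sup>2) > 0"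
    by (simp_all add: divide_le_eq)
  then show ?thesis by simp
qed

text \<open>The denominator D is at least \<open>1 + (exp x - t)^2\<close>, hence at least 1 and at least \<open>exp x - t\<close>.\<close>

lemma periodic_profile_le:
  fixes x y t :: real
  assumes t: "t \<ge> 0"
  shows "ln (2 * exp x / (1 + t\<^sup>2 + 2 * t * exp x * cos y + exp (2 * x))) \<le> ln (2 * (1 + t))"
proof -
  define e where "e = exp x"
  have e: "e > 0" by (simp add: e_def)
  define D where "D = 1 + t\<^sup>2 + 2 * t * e * cos y + exp (2 * x)"
  have "2 * t * e * cos y \<ge> 2 * t * e * (- 1)" using t e by (intro mult_left_mono) auto
  moreover have "exp (2 * x) = e\<^sup>2" by (simp add: e_def exp_double)
  ultimately have D: "D \<ge> 1 + (e - t)\<^sup>2"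
    by (simp add: D_def power2_diff algebra_simps)
  have sq: "(e - t)\<^sup>2 \<ge> 0" by simp
  have D1: "D \<ge> 1" using D sq by linarith
  have "e - t \<le> 1 + (e - t)\<^sup>2"
  proof -
    have "0 \<le> (e - t - 1 / 2)\<^sup>2" by simp
    then show ?thesis by (simp add: power2_eq_square algebra_simps)
  qed
  then have "e \<le> D + t" using D by linarith
  also have "\<dots> \<le> D + t * D" using D1 t mult_left_mono[of 1 D t] by simp
  finally have "2 * e \<le> 2 * (1 + t) * D" by (simp add: algebra_simps)
  then have "2 * e / D \<le> 2 * (1 + t)" using D1 by (simp add: pos_divide_le_eq)
  then show ?thesis using e D1 unfolding e_def[symmetric] D_def[symmetric] by (intro ln_mono) auto
qed

theorem theorem1p6:
  fixes u :: "complex \<Rightarrow> real"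
  assumes "liouville_solution u"
  shows "bdd_above (range u) \<longleftrightarrow>
    (\<exists>(l::complex) (z0::complex) (U::complex \<Rightarrow> real).
       l \<noteq> 0 \<and>
       (\<forall>z. u z = ln (cmod l) + U (l * z + z0)) \<and>
       ((\<forall>x y. U (Complex x y) = ln (2 / (1 + x\<^sup>2 + y\<^sup>2))) \<or>
        (\<exists>t::real. t \<ge> 0 \<and>
           (\<forall>x y. U (Complex x y) =
              ln (2 * exp x / (1 + t\<^sup>2 + 2 * t * exp x * cos y + exp (2 * x)))))))"
    (is "_ \<longleftrightarrow> ?R")
proof
  assume "bdd_above (range u)"
  then obtain M where M: "\<And>z. u z \<le> M" by (auto simp: bdd_above_def)
  obtain p q where "liouville_field u p q" using liouville_solution_field[OF assms] by blast
  then interpret bounded_liouville_field u p q M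
    using M by (simp add: bounded_liouville_field_def bounded_liouville_field_axioms_def)
  obtain k where "\<And>z. q z = k" using q_constant by blast
  then have "q = (\<lambda>z. k)" by auto
  then interpret constant_schwarzian u p k
    using liouville_field_axioms by (simp add: constant_schwarzian_def)
  show ?R
  proof (cases "k = 0")
    case True
    obtain l z0 where "l \<noteq> 0"
      "\<And>z. u z = ln (cmod l) + ln (2 / (1 + (Re (l * z + z0))\<^sup>2 + (Im (l * z + z0))\<^sup>2))"
      using zero_case[OF True] by blast
    then show ?thesis
      by (intro exI[of _ l] exI[of _ z0] exI[of _ "\<lambda>w. ln (2 / (1 + (Re w)\<^sup>2 + (Im w)\<^sup>2))"]) simp
  next
    case False
    obtain l z0 t where "l \<noteq> 0" "t \<ge> 0"
      "\<And>z. u z = ln (cmod l) + ln (2 * exp (Re (l * z + z0)) /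
        (1 + t\<^sup>2 + 2 * t * exp (Re (l * z + z0)) * cos (Im (l * z + z0)) + exp (2 * Re (l * z + z0))))"
      using nonzero_case[OF False] by blast
    then show ?thesis
      by (intro exI[of _ l] exI[of _ z0] exI[of _ "\<lambda>w. ln (2 * exp (Re w) /
        (1 + t\<^sup>2 + 2 * t * exp (Re w) * cos (Im w) + exp (2 * Re w)))"]) auto
  qed
next
  assume ?R
  then obtain l z0 U where u: "\<And>z. u z = ln (cmod l) + U (l * z + z0)"
    and U: "(\<forall>x y. U (Complex x y) = ln (2 / (1 + x\<^sup>2 + y\<^sup>2))) \<or>
        (\<exists>t::real. t \<ge> 0 \<and> (\<forall>x y. U (Complex x y) =
              ln (2 * exp x / (1 + t\<^sup>2 + 2 * t * exp x * cos y + exp (2 * x)))))"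
    by blast
  have "\<exists>K. \<forall>x y. U (Complex x y) \<le> K"
    using U spherical_profile_le periodic_profile_le by metis
  then obtain K where "\<And>w. U w \<le> K" by (metis complex_surj)
  then have "\<And>z. u z \<le> ln (cmod l) + K" by (simp add: u)
  then show "bdd_above (range u)" by (auto simp: bdd_above_def)
qed

end
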